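(* Let $\{X_t\}_{t\ge 0}$ be a semi-Lévy process on $\mathbb{R}^d$ with period $p>0$ and let $\psi(z)=\log E[e^{i\langle z,X_p\rangle}]$, $z\in\mathbb{R}^d$, be the logarithm of the characteristic function of $X_p$. Fix $a>0$. Then the following three statements are equivalent. (i) $\{X_t\}_{t\ge 0}$ is recurrent. (ii) $\lim_{q\downarrow 0}\int_{B_a}\mathrm{Re}\left(\frac{1}{q-\psi(z)}\right)dz=\infty$. (iii) $\limsup_{q\downarrow 0}\int_{B_a}\mathrm{Re}\left(\frac{1}{q-\psi(z)}\right)dz=\infty$.
   Context: An additive process on $\mathbb{R}^d$ is an $\mathbb{R}^d$-valued stochastic process $\{X_t\}_{t\ge 0}$ with $X_0=0$ a.s. that is stochastically continuous, has independent increments, and has sample paths that are right-continuous in $t\ge 0$ with left limits in $t>0$. A semi-Lévy process with period $p>0$ is an additive process such that $X_{t+p}-X_{s+p}$ and $X_t-X_s$ have the same distribution for all $s,t\ge 0$. The law of $X_p$ is infinitely divisible, so its characteristic function has no zeros; $\psi$ is its distinguished logarithm, i.e. the unique continuous function with $\psi(0)=0$ and $e^{\psi(z)}=E[e^{i\langle z,X_p\rangle}]$. An additive process $\{X_t\}_{t\ge0}$ is recurrent if $\liminf_{t\to\infty}|X_t-X_s|=0$ a.s. for every $s\ge 0$. Notation: $|x|$ is the Euclidean norm and $B_a=\{x\in\mathbb{R}^d: |x|<a\}$. *)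

theory Defs
  imports "HOL-Probability.Probability"
begin

(* Processes are families X t indexed by real t; only the values at times t >= 0 are constrained. *)

locale additive_process = prob_space M
  for M :: "'w measure" +
  fixes X :: "real \<Rightarrow> 'w \<Rightarrow> 'a::euclidean_space"
  assumes X_measurable: "\<And>t. 0 \<le> t \<Longrightarrow> X t \<in> borel_measurable M"
    and start_zero: "AE \<omega> in M. X 0 \<omega> = 0"
    and stochastically_continuous:
      "\<And>t \<epsilon>. 0 \<le> t \<Longrightarrow> 0 < \<epsilon> \<Longrightarrow>
         ((\<lambda>s. prob {\<omega> \<in> space M. \<epsilon> < norm (X s \<omega> - X t \<omega>)}) \<longlongrightarrow> 0) (at t within {0..})"
    and independent_increments:
      "\<And>(n::nat) (t::nat \<Rightarrow> real). 0 \<le> t 0 \<Longrightarrow> (\<And>i. i < n \<Longrightarrow> t i < t (Suc i)) \<Longrightarrow>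
         indep_vars (\<lambda>_. borel) (\<lambda>i \<omega>. X (t (Suc i)) \<omega> - X (t i) \<omega>) {..<n}"
    and right_continuous:
      "\<And>\<omega> t. \<omega> \<in> space M \<Longrightarrow> 0 \<le> t \<Longrightarrow> continuous (at_right t) (\<lambda>s. X s \<omega>)"
    and left_limits:
      "\<And>\<omega> t. \<omega> \<in> space M \<Longrightarrow> 0 < t \<Longrightarrow> \<exists>l. ((\<lambda>s. X s \<omega>) \<longlongrightarrow> l) (at_left t)"

locale semi_Levy_process = additive_process M X
  for M :: "'w measure" and X :: "real \<Rightarrow> 'w \<Rightarrow> 'a::euclidean_space" +
  fixes p :: real
  assumes period_pos: "0 < p"
    and periodic_increments:
      "\<And>s t. 0 \<le> s \<Longrightarrow> 0 \<le> t \<Longrightarrow>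
         distr M borel (\<lambda>\<omega>. X (t + p) \<omega> - X (s + p) \<omega>) = distr M borel (\<lambda>\<omega>. X t \<omega> - X s \<omega>)"

definition recurrent_process :: "'w measure \<Rightarrow> (real \<Rightarrow> 'w \<Rightarrow> 'a::euclidean_space) \<Rightarrow> bool" where
  "recurrent_process M X \<longleftrightarrow>
     (\<forall>s\<ge>0. AE \<omega> in M. Liminf at_top (\<lambda>t. ereal (norm (X t \<omega> - X s \<omega>))) = 0)"

(* The library's char covers only measures on the real line. *)
definition char_fun :: "'w measure \<Rightarrow> ('w \<Rightarrow> 'a::euclidean_space) \<Rightarrow> 'a \<Rightarrow> complex" where
  "char_fun M Y z = (LINT \<omega>|M. exp (\<i> * complex_of_real (z \<bullet> Y \<omega>)))"

(* Not the principal branch Ln of the logarithm: the continuous lift vanishing at the origin.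
   It exists and is unique for continuous zero-free f with f 0 = 1; see below. *)
definition distinguished_log :: "('a::euclidean_space \<Rightarrow> complex) \<Rightarrow> 'a \<Rightarrow> complex" where
  "distinguished_log f =
     (THE g. continuous_on UNIV g \<and> g 0 = 0 \<and> (\<forall>z. exp (g z) = f z))"

lemma distinguished_log_ex1:
  fixes f :: "'a::euclidean_space \<Rightarrow> complex"
  assumes f: "continuous_on UNIV f" "\<And>z. f z \<noteq> 0" "f 0 = 1"
  shows "\<exists>!g. continuous_on UNIV g \<and> g 0 = 0 \<and> (\<forall>z. exp (g z) = f z)"
proof (rule ex_ex1I)
  obtain h where h: "continuous_on UNIV h" "\<And>z. f z = exp (h z)"
    using continuous_logarithm_on_contractible[of UNIV f] f
    by (metis UNIV_I contractible_UNIV)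
  have "exp (h z - h 0) = f z" for z
    using h(2)[of 0] h(2)[of z] f(3) by (simp add: exp_diff)
  then show "\<exists>g. continuous_on UNIV g \<and> g 0 = 0 \<and> (\<forall>z. exp (g z) = f z)"
    using h(1) by (intro exI[of _ "\<lambda>z. h z - h 0"]) (auto intro!: continuous_intros)
next
  fix g h
  assume g: "continuous_on UNIV g \<and> g 0 = 0 \<and> (\<forall>z. exp (g z) = f z)"
    and h: "continuous_on UNIV h \<and> h 0 = 0 \<and> (\<forall>z. exp (h z) = f z)"
  define D where "D z = g z - h z" for z
  have expD: "exp (D z) = 1" for z
    using g h f(2)[of z] by (simp add: D_def exp_diff)
  have "D constant_on UNIV"
  proof (rule continuous_discrete_range_constant)
    show "connected (UNIV :: 'a set)" by (rule connected_UNIV)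
    show "continuous_on UNIV D"
      unfolding D_def using g h by (intro continuous_intros) auto
    fix x :: 'a
    have "1 \<le> norm (D y - D x)" if "D y \<noteq> D x" for y
    proof (rule ccontr)
      assume "\<not> 1 \<le> norm (D y - D x)"
      then have "\<bar>Im (D y) - Im (D x)\<bar> < 2 * pi"
        using abs_Im_le_cmod[of "D y - D x"] pi_gt3 by simp
      then show False
        using that exp_complex_eqI[of "D y" "D x"] expD by metis
    qed
    then show "\<exists>e>0. \<forall>y. y \<in> UNIV \<and> D y \<noteq> D x \<longrightarrow> e \<le> norm (D y - D x)"
      by (intro exI[of _ 1]) auto
  qed
  moreover have "D 0 = 0"
    using g h by (simp add: D_def)
  ultimately have "D z = 0" for z
    unfolding constant_on_def by (metis UNIV_I)
  then show "g = h"
    by (auto simp: D_def)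
qed

end

theory Submission
  imports Defs "HOL-Real_Asymp.Real_Asymp"
begin

text \<open>
  Let \<open>\<phi> = exp \<psi>\<close> be the characteristic function of \<open>X p\<close>. The process is compared with the random
  walks \<open>n \<mapsto> X (s + n p) - X s\<close> that it traces along its period, and \<open>1 / (q - \<psi>)\<close> with the
  resolvent \<open>1 / (1 - r \<phi>)\<close> of these walks at \<open>r = exp (- q)\<close>; what remains is a Chung--Fuchs
  argument for random walks.

  All these walks have steps with characteristic function \<open>\<phi>\<close>, whatever \<open>s\<close> is:
  the characteristic functions of \<open>X s\<close>, \<open>X (s + p)\<close> and \<open>X p\<close> are linked by multiplicativity over
  increments, and that of \<open>X s\<close> can be cancelled since it has no zeros
  (\<open>char_fun_period_increment\<close>, \<open>char_fun_nonzero\<close>). With \<open>w = q - \<psi>\<close> one has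
  \<open>1 - r \<phi> = 1 - exp (- w)\<close>, and \<open>1 / (1 - exp (- w)) - 1 / w\<close> is bounded near \<open>w = 0\<close>. Where \<open>\<psi>\<close> is
  not small, \<open>1 / w\<close> is bounded and the real part of \<open>1 / (1 - exp (- w))\<close> is nonnegative. So the
  integral over \<open>B\<^sub>a\<close> of the real part of \<open>1 / (q - \<psi>)\<close> is at most that of the walk resolvent
  plus a constant, and on a small ball around the origin the converse estimate holds as well
  (\<open>resolvent_compare\<close>). In this way the points \<open>z \<noteq> 0\<close> with \<open>\<psi> z = 0\<close>, which can occur for
  lattice distributions, need no separate treatment.

  If the process is not recurrent, one of the walks stays away from its starting point with
  positive probability from some time on. A last-exit argument bounds its expected number of visits
  to a small ball, uniformly in the centre (\<open>occupation_bound_if_transient\<close>). Averaging over the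
  centre bounds \<open>\<Sum>\<^sub>n E exp (- |S\<^sub>n|\<^sup>2 / 2)\<close>, and as the Gaussian is, up to a constant, its own
  Fourier transform, this sum is, up to the same constant, the limit as \<open>r\<close> tends to 1 of
  Gaussian integrals of the walk resolvent. So the integrals over \<open>B\<^sub>a\<close> stay bounded.

  If, conversely, these integrals do not tend to infinity, they are bounded along some sequence
  \<open>q \<rightarrow> 0\<close>. Testing with the kernel \<open>|\<integral>\<^sub>B exp (i y \<bullet> x) dy|\<^sup>2\<close>, whose Fourier transform lives on a small
  ball, yields \<open>\<Sum>\<^sub>n P (|S\<^sub>n| < K) < \<infinity>\<close> for every \<open>K\<close>
  (\<open>occupation_bounded_if_resolvent_bounded\<close>). Within one period the process seldom moves far, so an
  Ottaviani inequality carries this over to continuous time: the probability that the process comes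
  within distance 1 of its starting point during the \<open>n\<close>-th period is at most twice
  \<open>P (|S\<^sub>n\<^sub>+\<^sub>1| < K + 1)\<close> for a suitable \<open>K\<close>. By Borel--Cantelli the process almost surely stops returning.
\<close>

section \<open>Gaussian integrals on Euclidean space\<close>

text \<open>
  Lebesgue measure is the image of a product of one-dimensional Lebesgue measures; this is Fubini for
  products of functions of the single coordinates.
\<close>

lemma integrable_lborel_prod:
  fixes f :: "'a::euclidean_space \<Rightarrow> real \<Rightarrow> 'c::{real_normed_field,banach,second_countable_topology}"
  assumes "\<And>b. b \<in> Basis \<Longrightarrow> integrable lborel (f b)"
  shows "integrable lborel (\<lambda>x::'a. \<Prod>b\<in>Basis. f b (x \<bullet> b))"
    and "(LINT x|(lborel::'a measure). (\<Prod>b\<in>Basis. f b (x \<bullet> b))) = (\<Prod>b\<in>Basis. (LINT t|lborel. f b t))"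
proof -
  have [measurable]: "f b \<in> borel_measurable borel" if "b \<in> Basis" for b
    using borel_measurable_integrable[OF assms[OF that]] by simp
  interpret product_sigma_finite "\<lambda>_::'a. lborel :: real measure"
    by (rule product_sigma_finite.intro) (rule sigma_finite_lborel)
  have m: "(\<lambda>x::'a. \<Prod>b\<in>Basis. f b (x \<bullet> b)) \<in> borel_measurable borel"
    by measurable
  have s: "(\<lambda>g. \<Sum>b\<in>Basis. g b *\<^sub>R b) \<in> measurable (\<Pi>\<^sub>M b\<in>Basis. lborel) (borel :: 'a measure)"
    by measurable
  have c: "(\<Sum>b'\<in>Basis. g b' *\<^sub>R b') \<bullet> b = g b" if "b \<in> Basis" for g and b :: 'a
    using that by simp
  show "integrable lborel (\<lambda>x::'a. \<Prod>b\<in>Basis. f b (x \<bullet> b))"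
    apply (subst lborel_eq, subst integrable_distr_eq[OF s m])
    using product_integrable_prod[of Basis f] assms by (simp add: c cong: prod.cong)
  show "(LINT x|(lborel::'a measure). (\<Prod>b\<in>Basis. f b (x \<bullet> b))) = (\<Prod>b\<in>Basis. (LINT t|lborel. f b t))"
    apply (subst lborel_eq, subst integral_distr[OF s m])
    using product_integral_prod[of Basis f] assms by (simp add: c cong: prod.cong)
qed

lemma norm_sq_eq_sum: "(norm x)\<^sup>2 = (\<Sum>b\<in>Basis. (x \<bullet> b)\<^sup>2)" for x :: "'a::euclidean_space"
  by (subst power2_norm_eq_inner, subst euclidean_inner) (simp add: power2_eq_square)

lemma integrable_exp_neg_norm_sq:
  fixes c :: real assumes "0 < c"
  shows "integrable lborel (\<lambda>x::'a::euclidean_space. exp (- (c * (norm x)\<^sup>2)))"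
proof -
  define s where "s = 1 / sqrt (2 * c)"
  have s: "0 < s" "2 * s\<^sup>2 = 1 / c"
    using assms by (auto simp: s_def power_divide)
  have "integrable lborel (\<lambda>t::real. exp (- (c * t\<^sup>2)))"
  proof -
    have "integrable lborel (\<lambda>t. sqrt (2 * pi * s\<^sup>2) * normal_density 0 s t)"
      using s by (intro integrable_mult_right integrable_normal_density) auto
    moreover have "sqrt (2 * pi * s\<^sup>2) * normal_density 0 s t = exp (- (c * t\<^sup>2))" for t
      using s assms by (simp add: normal_density_def field_simps)
    ultimately show ?thesis by simp
  qed
  then have "integrable lborel (\<lambda>x::'a. \<Prod>b\<in>Basis. exp (- (c * (x \<bullet> b)\<^sup>2)))"
    by (intro integrable_lborel_prod)
  also have "(\<lambda>x::'a. \<Prod>b\<in>Basis. exp (- (c * (x \<bullet> b)\<^sup>2))) = (\<lambda>x. exp (- (c * (norm x)\<^sup>2)))"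
    by (simp add: norm_sq_eq_sum exp_sum[symmetric] sum_negf sum_distrib_left)
  finally show ?thesis .
qed

text \<open>
  The one-dimensional case restates the characteristic function of the standard normal distribution.
\<close>

lemma gaussian_fourier_1d:
  fixes t :: real
  shows "integrable lborel (\<lambda>x. complex_of_real (exp (- (x\<^sup>2 / 2))) * exp (\<i> * complex_of_real (x * t)))"
    and "(LINT x|lborel. complex_of_real (exp (- (x\<^sup>2 / 2))) * exp (\<i> * complex_of_real (x * t)))
      = complex_of_real (sqrt (2 * pi) * exp (- (t\<^sup>2 / 2)))"
proof -
  have e: "complex_of_real (exp (- (x\<^sup>2 / 2))) * exp (\<i> * complex_of_real (x * t))
      = complex_of_real (sqrt (2 * pi)) * (std_normal_density x *\<^sub>R iexp (t * x))" for x
    by (simp add: std_normal_density_def scaleR_conv_of_real mult_ac)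
  have i: "integrable lborel (\<lambda>x. std_normal_density x *\<^sub>R iexp (t * x))"
  proof (rule Bochner_Integration.integrable_bound[where f="std_normal_density"])
    show "integrable lborel std_normal_density" by (rule integrable_normal_density) simp
  qed auto
  show "integrable lborel (\<lambda>x. complex_of_real (exp (- (x\<^sup>2 / 2))) * exp (\<i> * complex_of_real (x * t)))"
    unfolding e using i by (rule integrable_mult_right)
  have "(LINT x|lborel. std_normal_density x *\<^sub>R iexp (t * x)) = char std_normal_distribution t"
    unfolding char_def by (subst integral_density) auto
  then show "(LINT x|lborel. complex_of_real (exp (- (x\<^sup>2 / 2))) * exp (\<i> * complex_of_real (x * t)))
      = complex_of_real (sqrt (2 * pi) * exp (- (t\<^sup>2 / 2)))"
    unfolding e by (simp add: char_std_normal_distribution del: mult_scaleR_right)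
qed

lemma gaussian_fourier:
  fixes x :: "'a::euclidean_space"
  shows "(LINT z|lborel. complex_of_real (exp (- ((norm z)\<^sup>2 / 2))) * exp (\<i> * complex_of_real (z \<bullet> x)))
      = complex_of_real (sqrt (2 * pi) ^ DIM('a) * exp (- ((norm x)\<^sup>2 / 2)))"
proof -
  let ?f = "\<lambda>b t. complex_of_real (exp (- (t\<^sup>2 / 2))) * exp (\<i> * complex_of_real (t * (x \<bullet> b)))"
  have "complex_of_real (exp (- ((norm z)\<^sup>2 / 2))) * exp (\<i> * complex_of_real (z \<bullet> x))
      = (\<Prod>b\<in>Basis. ?f b (z \<bullet> b))" for z :: 'a
    unfolding prod.distrib of_real_prod[symmetric]
    by (subst exp_sum[symmetric], simp)+
       (simp add: norm_sq_eq_sum euclidean_inner[of z x] sum_negf sum_divide_distrib sum_distrib_left)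
  then have "(LINT z|lborel. complex_of_real (exp (- ((norm z)\<^sup>2 / 2))) * exp (\<i> * complex_of_real (z \<bullet> x)))
      = (\<Prod>b\<in>Basis. (LINT t|lborel. ?f b t))"
    using integrable_lborel_prod(2)[of ?f] gaussian_fourier_1d(1) by simp
  also have "\<dots> = (\<Prod>b\<in>(Basis::'a set). complex_of_real (sqrt (2 * pi) * exp (- ((x \<bullet> b)\<^sup>2 / 2))))"
    by (simp only: gaussian_fourier_1d(2))
  also have "\<dots> = complex_of_real (sqrt (2 * pi) ^ DIM('a) * exp (- ((norm x)\<^sup>2 / 2)))"
    unfolding of_real_prod[symmetric] prod.distrib
    by (simp add: norm_sq_eq_sum exp_sum[symmetric] sum_negf sum_divide_distrib)
  finally show ?thesis .
qed

section \<open>Characteristic functions of random vectors\<close>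

lemma norm_exp_i [simp]: "norm (exp (\<i> * complex_of_real t)) = 1"
  by (rule norm_exp_i_times)

lemma (in prob_space) char_fun_measurable:
  fixes Y :: "'a \<Rightarrow> 'b::euclidean_space"
  assumes [measurable]: "Y \<in> borel_measurable M"
  shows "char_fun M Y \<in> borel_measurable borel"
  unfolding char_fun_def by measurable

lemma (in prob_space) integrable_exp_i:
  fixes f :: "'a \<Rightarrow> real"
  assumes [measurable]: "f \<in> borel_measurable M"
  shows "integrable M (\<lambda>\<omega>. exp (\<i> * complex_of_real (f \<omega>)))"
  by (rule integrable_const_bound[where B=1]) auto

lemma (in prob_space) norm_char_fun_le_1:
  fixes Y :: "'a \<Rightarrow> 'b::euclidean_space"
  assumes [measurable]: "Y \<in> borel_measurable M"
  shows "norm (char_fun M Y z) \<le> 1"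
proof -
  have "norm (char_fun M Y z) \<le> (LINT \<omega>|M. norm (exp (\<i> * complex_of_real (z \<bullet> Y \<omega>))))"
    unfolding char_fun_def by (rule integral_norm_bound)
  then show ?thesis by (simp add: prob_space)
qed

lemma (in prob_space) char_fun_sum:
  fixes \<xi> :: "nat \<Rightarrow> 'a \<Rightarrow> 'b::euclidean_space"
  assumes "indep_vars (\<lambda>_. borel) \<xi> I" "finite I"
  shows "char_fun M (\<lambda>\<omega>. \<Sum>i\<in>I. \<xi> i \<omega>) z = (\<Prod>i\<in>I. char_fun M (\<xi> i) z)"
proof -
  have m: "\<xi> i \<in> borel_measurable M" if "i \<in> I" for i
    using assms that by (auto simp: indep_vars_def)
  have i: "indep_vars (\<lambda>_. borel) (\<lambda>i \<omega>. exp (\<i> * complex_of_real (z \<bullet> \<xi> i \<omega>))) I"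
    by (rule indep_vars_compose2[OF assms(1), where Y="\<lambda>_ x. exp (\<i> * complex_of_real (z \<bullet> x))"]) measurable
  have "char_fun M (\<lambda>\<omega>. \<Sum>i\<in>I. \<xi> i \<omega>) z = (LINT \<omega>|M. (\<Prod>i\<in>I. exp (\<i> * complex_of_real (z \<bullet> \<xi> i \<omega>))))"
    unfolding char_fun_def using assms(2)
    by (simp add: inner_sum_right sum_distrib_left exp_sum)
  also have "\<dots> = (\<Prod>i\<in>I. char_fun M (\<xi> i) z)"
    unfolding char_fun_def
    using assms(2) i m by (intro indep_vars_lebesgue_integral integrable_exp_i) auto
  finally show ?thesis .
qed

lemma (in prob_space) char_fun_zero: "char_fun M (\<lambda>_. 0) z = 1"
  by (simp add: char_fun_def prob_space)

lemma (in prob_space) char_fun_cong_AE: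
  assumes "AE \<omega> in M. Y \<omega> = Y' \<omega>" "Y \<in> borel_measurable M" "Y' \<in> borel_measurable M"
  shows "char_fun M Y z = char_fun M Y' z"
  unfolding char_fun_def using assms by (intro integral_cong_AE) auto

lemma char_fun_uminus: "char_fun M (\<lambda>\<omega>. - Y \<omega>) z = cnj (char_fun M Y z)"
  unfolding char_fun_def by (subst Bochner_Integration.integral_cnj[symmetric]) (simp add: exp_cnj)

lemma char_fun_eq_if_distr_eq:
  assumes "distr M borel Y = distr M borel Y'" "Y \<in> borel_measurable M" "Y' \<in> borel_measurable M"
  shows "char_fun M Y z = char_fun M Y' z"
proof -
  have "char_fun M V z = (LINT x|distr M borel V. exp (\<i> * complex_of_real (z \<bullet> x)))"
    if "V \<in> borel_measurable M" for V
    unfolding char_fun_def using that by (subst integral_distr) auto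
  then show ?thesis using assms by simp
qed

text \<open>
  Where \<open>|Y| \<le> \<epsilon>\<close> the integrand \<open>exp (i z \<bullet> Y) - 1\<close> has modulus at most \<open>\<epsilon> |z|\<close>; elsewhere it is at
  most 2.
\<close>

lemma (in prob_space) char_fun_near_1:
  fixes Y :: "'a \<Rightarrow> 'b::euclidean_space"
  assumes [measurable]: "Y \<in> borel_measurable M" and "0 \<le> \<epsilon>"
  shows "norm (char_fun M Y z - 1) \<le> \<epsilon> * norm z + 2 * prob {\<omega>\<in>space M. \<epsilon> < norm (Y \<omega>)}"
proof -
  let ?e = "\<lambda>\<omega>. exp (\<i> * complex_of_real (z \<bullet> Y \<omega>))"
  have "char_fun M Y z - 1 = (LINT \<omega>|M. ?e \<omega> - 1)"
    unfolding char_fun_def using integrable_exp_i[of "\<lambda>\<omega>. z \<bullet> Y \<omega>"]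
    by (subst Bochner_Integration.integral_diff) (auto simp: prob_space)
  also have "norm \<dots> \<le> (LINT \<omega>|M. norm (?e \<omega> - 1))" by (rule integral_norm_bound)
  also have "\<dots> \<le> (LINT \<omega>|M. \<epsilon> * norm z + 2 * indicator {\<omega>\<in>space M. \<epsilon> < norm (Y \<omega>)} \<omega>)"
  proof (rule integral_mono_AE')
    show "integrable M (\<lambda>\<omega>. \<epsilon> * norm z + 2 * indicator {\<omega>\<in>space M. \<epsilon> < norm (Y \<omega>)} \<omega>)"
      by (intro Bochner_Integration.integrable_add integrable_mult_right integrable_real_indicator) (auto simp: less_top[symmetric])
    have "norm (?e \<omega> - 1) \<le> \<epsilon> * norm z + 2 * indicator {\<omega>\<in>space M. \<epsilon> < norm (Y \<omega>)} \<omega>" if "\<omega> \<in> space M" for \<omega>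
    proof (cases "\<epsilon> < norm (Y \<omega>)")
      case True
      have "norm (?e \<omega> - 1) \<le> 2" using norm_triangle_ineq4[of "?e \<omega>" 1] by simp
      then show ?thesis using True that assms(2) by (simp add: add_increasing)
    next
      case False
      have "norm (?e \<omega> - 1) \<le> \<bar>z \<bullet> Y \<omega>\<bar>" using iexp_approx1[of "z \<bullet> Y \<omega>" 0] by simp
      also have "\<dots> \<le> norm z * norm (Y \<omega>)" by (rule Cauchy_Schwarz_ineq2)
      also have "\<dots> \<le> norm z * \<epsilon>" using False by (intro mult_left_mono) auto
      finally show ?thesis using False by (simp add: mult.commute)
    qed
    then show "AE \<omega> in M. norm (?e \<omega> - 1) \<le> \<epsilon> * norm z + 2 * indicator {\<omega>\<in>space M. \<epsilon> < norm (Y \<omega>)} \<omega>"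
      by auto
    show "AE \<omega> in M. 0 \<le> \<epsilon> * norm z + 2 * indicator {\<omega>\<in>space M. \<epsilon> < norm (Y \<omega>)} \<omega>"
      using assms(2) by (auto split: split_indicator)
  qed
  also have "\<dots> = \<epsilon> * norm z + 2 * prob {\<omega>\<in>space M. \<epsilon> < norm (Y \<omega>)}"
    by (subst Bochner_Integration.integral_add) (auto simp: prob_space less_top[symmetric] intro!: integrable_mult_right integrable_real_indicator)
  finally show ?thesis .
qed

lemma (in prob_space) continuous_char_fun:
  fixes Y :: "'a \<Rightarrow> 'b::euclidean_space"
  assumes [measurable]: "Y \<in> borel_measurable M"
  shows "continuous_on UNIV (char_fun M Y)"
proof (rule continuous_at_imp_continuous_on, rule ballI)
  fix z :: 'b
  show "isCont (char_fun M Y) z"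
    unfolding continuous_at_sequentially
  proof safe
    fix x assume x: "x \<longlonglongrightarrow> z"
    show "(char_fun M Y \<circ> x) \<longlonglongrightarrow> char_fun M Y z"
      unfolding char_fun_def comp_def
      by (rule integral_dominated_convergence[where w="\<lambda>_. 1"]) (auto intro!: tendsto_intros x)
  qed
qed

lemma (in prob_space) tight:
  fixes Y :: "'a \<Rightarrow> 'b::euclidean_space"
  assumes [measurable]: "Y \<in> borel_measurable M" and "0 < e"
  shows "\<exists>K. prob {\<omega>\<in>space M. K \<le> norm (Y \<omega>)} < e"
proof -
  let ?A = "\<lambda>n. {\<omega>\<in>space M. real n \<le> norm (Y \<omega>)}"
  have "(\<lambda>n. prob (?A n)) \<longlonglongrightarrow> prob (\<Inter>n. ?A n)"
    by (rule finite_Lim_measure_decseq) (auto simp: decseq_def)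
  moreover have "(\<Inter>n. ?A n) = {}"
    using reals_Archimedean2 by (auto simp: set_eq_iff not_le)
  ultimately have "(\<lambda>n. prob (?A n)) \<longlonglongrightarrow> 0" by simp
  then have "\<forall>\<^sub>F n in sequentially. prob (?A n) < e" using assms(2) by (rule order_tendstoD)
  then show ?thesis by (auto simp: eventually_sequentially)
qed

section \<open>Independent blocks of variables\<close>

lemma (in prob_space) indep_vars_disjoint_blocks:
  assumes "indep_vars (\<lambda>_. N) \<xi> I" "A \<inter> B = {}" "A \<subseteq> I" "B \<subseteq> I"
    and P: "Measurable.pred (PiM A (\<lambda>_. N)) P" and Q: "Measurable.pred (PiM B (\<lambda>_. N)) Q"
  shows "prob {\<omega>\<in>space M. P (\<lambda>i\<in>A. \<xi> i \<omega>) \<and> Q (\<lambda>i\<in>B. \<xi> i \<omega>)}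
       = prob {\<omega>\<in>space M. P (\<lambda>i\<in>A. \<xi> i \<omega>)} * prob {\<omega>\<in>space M. Q (\<lambda>i\<in>B. \<xi> i \<omega>)}"
proof -
  let ?f = "\<lambda>C \<omega>. \<lambda>i\<in>C. \<xi> i \<omega>"
  have i: "indep_var (PiM A (\<lambda>_. N)) (?f A) (PiM B (\<lambda>_. N)) (?f B)"
    by (rule indep_var_restrict) fact+
  have sp: "?f A \<in> measurable M (PiM A (\<lambda>_. N))" "?f B \<in> measurable M (PiM B (\<lambda>_. N))"
    using indep_var_rv1[OF i] indep_var_rv2[OF i] by auto
  let ?SA = "{f\<in>space (PiM A (\<lambda>_. N)). P f}" and ?SB = "{f\<in>space (PiM B (\<lambda>_. N)). Q f}"
  have "prob ((\<lambda>x. (?f A x, ?f B x)) -` (?SA \<times> ?SB) \<inter> space M)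
     = prob (?f A -` ?SA \<inter> space M) * prob (?f B -` ?SB \<inter> space M)"
    using P Q by (intro indep_varD[OF i]) (auto simp: pred_def)
  moreover have "(\<lambda>x. (?f A x, ?f B x)) -` (?SA \<times> ?SB) \<inter> space M = {\<omega>\<in>space M. P (?f A \<omega>) \<and> Q (?f B \<omega>)}"
    "?f A -` ?SA \<inter> space M = {\<omega>\<in>space M. P (?f A \<omega>)}"
    "?f B -` ?SB \<inter> space M = {\<omega>\<in>space M. Q (?f B \<omega>)}"
    using sp[THEN measurable_space] by auto
  ultimately show ?thesis by simp
qed

lemma borel_measurable_sum_components:
  fixes g :: "'i \<Rightarrow> 'j"
  assumes "\<And>i. i \<in> J \<Longrightarrow> g i \<in> A"
  shows "(\<lambda>f. \<Sum>i\<in>J. f (g i) :: 'a::euclidean_space) \<in> borel_measurable (PiM A (\<lambda>_. borel))"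
  using assms by (intro borel_measurable_sum measurable_component_singleton) auto

text \<open>
  Decompose the event on the left according to the first index \<open>i \<in> I\<close> at which the partial sum is
  smaller than \<open>c\<close>. This first-hitting event depends on the variables before \<open>i\<close>, so it is
  independent of the remaining increment, which is smaller than \<open>K\<close> with probability at least one half
  and then keeps the final sum below \<open>c + K\<close>.
\<close>

lemma (in prob_space) ottaviani:
  fixes \<xi> :: "nat \<Rightarrow> 'a \<Rightarrow> 'b::euclidean_space"
  assumes ind: "indep_vars (\<lambda>_. borel) \<xi> {..<J}" and I: "I \<subseteq> {..J}"
    and half: "\<And>i. i \<in> I \<Longrightarrow> 1 / 2 \<le> prob {\<omega>\<in>space M. norm (\<Sum>k\<in>{i..<J}. \<xi> k \<omega>) < K}"
  shows "prob {\<omega>\<in>space M. \<exists>i\<in>I. norm (\<Sum>k<i. \<xi> k \<omega>) < c}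
    \<le> 2 * prob {\<omega>\<in>space M. norm (\<Sum>k<J. \<xi> k \<omega>) < c + K}"
proof -
  have fin: "finite I" using I finite_subset by blast
  have [measurable]: "\<xi> k \<in> borel_measurable M" if "k < J" for k
    using ind that by (auto simp: indep_vars_def)
  have m[measurable]: "(\<lambda>\<omega>. \<Sum>k\<in>C. \<xi> k \<omega>) \<in> borel_measurable M" if "C \<subseteq> {..<J}" for C
    using that by (intro borel_measurable_sum) auto
  define P where "P i f \<longleftrightarrow> norm (\<Sum>k<i. f k :: 'b) < c \<and> (\<forall>j\<in>I. j < i \<longrightarrow> c \<le> norm (\<Sum>k<j. f k))" for i and f :: "nat \<Rightarrow> 'b"
  define Q where "Q i f \<longleftrightarrow> norm (\<Sum>k\<in>{i..<J}. f k :: 'b) < K" for i and f :: "nat \<Rightarrow> 'b"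
  define F where "F i = {\<omega>\<in>space M. P i (\<lambda>k. \<xi> k \<omega>)}" for i
  define H where "H i = {\<omega>\<in>space M. Q i (\<lambda>k. \<xi> k \<omega>)}" for i
  have Fm: "F i \<in> events" and Hm: "H i \<in> events" if "i \<in> I" for i
  proof -
    have i: "i \<le> J" using that I by auto
    have mi: "(\<lambda>\<omega>. \<Sum>k<j. \<xi> k \<omega>) \<in> borel_measurable M" if "j \<le> i" for j
      using that i by (intro m) auto
    have "F i = {\<omega>\<in>space M. norm (\<Sum>k<i. \<xi> k \<omega>) < c} \<inter>
       {\<omega>\<in>space M. \<forall>j\<in>{j\<in>I. j < i}. c \<le> norm (\<Sum>k<j. \<xi> k \<omega>)}"
      by (auto simp: F_def P_def)
    also have "\<dots> \<in> events"
    proof (intro sets.Int sets.sets_Collect_finite_All)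
      show "{\<omega>\<in>space M. norm (\<Sum>k<i. \<xi> k \<omega>) < c} \<in> events"
        using mi[of i] by measurable
      show "{\<omega>\<in>space M. c \<le> norm (\<Sum>k<j. \<xi> k \<omega>)} \<in> events" if "j \<in> {j\<in>I. j < i}" for j
        proof -
        have [measurable]: "(\<lambda>\<omega>. \<Sum>k<j. \<xi> k \<omega>) \<in> borel_measurable M"
          using that by (intro mi) auto
        show ?thesis by measurable
      qed
    qed (use fin in auto)
    finally show "F i \<in> events" .
    have "(\<lambda>\<omega>. \<Sum>k\<in>{i..<J}. \<xi> k \<omega>) \<in> borel_measurable M" by (rule m) auto
    then show "H i \<in> events" unfolding H_def Q_def by measurable
  qed
  have indep: "prob (F i \<inter> H i) = prob (F i) * prob (H i)" if "i \<in> I" for i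
  proof -
    have i: "i \<le> J" using that I by auto
    have "Measurable.pred (PiM {..<i} (\<lambda>_. borel)) (P i)"
    proof -
      have 1: "Measurable.pred (PiM {..<i} (\<lambda>_. borel)) (\<lambda>f. norm (\<Sum>k<i. f k :: 'b) < c)"
        using borel_measurable_sum_components[of "{..<i}" "\<lambda>k. k" "{..<i}"] by measurable
      have 2: "Measurable.pred (PiM {..<i} (\<lambda>_. borel)) (\<lambda>f. c \<le> norm (\<Sum>k<j. f k :: 'b))" if "j < i" for j
        using borel_measurable_sum_components[of "{..<j}" "\<lambda>k. k" "{..<i}"] by measurable (use that in auto)
      have 3: "Measurable.pred (PiM {..<i} (\<lambda>_. borel)) (\<lambda>f. \<forall>j\<in>{j\<in>I. j < i}. c \<le> norm (\<Sum>k<j. f k :: 'b))"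
        using fin 2 by (intro pred_intros_finite) auto
      have e: "P i = (\<lambda>f. norm (\<Sum>k<i. f k) < c \<and> (\<forall>j\<in>{j\<in>I. j < i}. c \<le> norm (\<Sum>k<j. f k)))"
        by (auto simp: P_def fun_eq_iff)
      show ?thesis unfolding e using 1 3 by measurable
    qed
    moreover have "Measurable.pred (PiM {i..<J} (\<lambda>_. borel)) (Q i)"
      unfolding Q_def using borel_measurable_sum_components[of "{i..<J}" "\<lambda>k. k" "{i..<J}"] by measurable
    ultimately have "prob {\<omega>\<in>space M. P i (\<lambda>k\<in>{..<i}. \<xi> k \<omega>) \<and> Q i (\<lambda>k\<in>{i..<J}. \<xi> k \<omega>)}
       = prob {\<omega>\<in>space M. P i (\<lambda>k\<in>{..<i}. \<xi> k \<omega>)} * prob {\<omega>\<in>space M. Q i (\<lambda>k\<in>{i..<J}. \<xi> k \<omega>)}"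
      using i by (intro indep_vars_disjoint_blocks[OF ind]) auto
    moreover have "P i (\<lambda>k\<in>{..<i}. \<xi> k \<omega>) = P i (\<lambda>k. \<xi> k \<omega>)" "Q i (\<lambda>k\<in>{i..<J}. \<xi> k \<omega>) = Q i (\<lambda>k. \<xi> k \<omega>)" for \<omega>
      by (auto simp: P_def Q_def)
    moreover have "F i \<inter> H i = {\<omega>\<in>space M. P i (\<lambda>k. \<xi> k \<omega>) \<and> Q i (\<lambda>k. \<xi> k \<omega>)}"
      by (auto simp: F_def H_def)
    ultimately show ?thesis by (simp add: F_def H_def)
  qed
  have disj: "disjoint_family_on F I"
  proof (unfold disjoint_family_on_def, intro ballI impI)
    fix i j assume "i \<in> I" "j \<in> I" "i \<noteq> j"
    then show "F i \<inter> F j = {}"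
      by (cases i j rule: linorder_cases) (force simp: F_def P_def)+
  qed
  have cover: "{\<omega>\<in>space M. \<exists>i\<in>I. norm (\<Sum>k<i. \<xi> k \<omega>) < c} = (\<Union>i\<in>I. F i)" (is "?E = _")
  proof (intro equalityI subsetI)
    fix \<omega> assume w: "\<omega> \<in> ?E"
    define i where "i = (LEAST i. i \<in> I \<and> norm (\<Sum>k<i. \<xi> k \<omega>) < c)"
    have "i \<in> I \<and> norm (\<Sum>k<i. \<xi> k \<omega>) < c"
      unfolding i_def by (rule LeastI_ex) (use w in auto)
    moreover have "c \<le> norm (\<Sum>k<j. \<xi> k \<omega>)" if "j \<in> I" "j < i" for j
      using not_less_Least[of j "\<lambda>i. i \<in> I \<and> norm (\<Sum>k<i. \<xi> k \<omega>) < c"] that unfolding i_def by auto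
    ultimately show "\<omega> \<in> (\<Union>i\<in>I. F i)"
      using w by (auto simp: F_def P_def)
  qed (auto simp: F_def P_def)
  have sub: "(\<Union>i\<in>I. F i \<inter> H i) \<subseteq> {\<omega>\<in>space M. norm (\<Sum>k<J. \<xi> k \<omega>) < c + K}"
  proof clarify
    fix \<omega> i assume i: "i \<in> I" "\<omega> \<in> F i" "\<omega> \<in> H i"
    have "(\<Sum>k<J. \<xi> k \<omega>) = (\<Sum>k<i. \<xi> k \<omega>) + (\<Sum>k\<in>{i..<J}. \<xi> k \<omega>)"
      using i(1) I by (subst sum.union_disjoint[symmetric]) (auto intro!: sum.cong)
    then show "\<omega> \<in> space M \<and> norm (\<Sum>k<J. \<xi> k \<omega>) < c + K"
      using i norm_triangle_ineq[of "\<Sum>k<i. \<xi> k \<omega>" "\<Sum>k\<in>{i..<J}. \<xi> k \<omega>"]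
      by (auto simp: F_def P_def H_def Q_def)
  qed
  have "prob ?E = (\<Sum>i\<in>I. prob (F i))"
    unfolding cover using fin Fm disj by (intro finite_measure_finite_Union) auto
  also have "\<dots> \<le> (\<Sum>i\<in>I. 2 * prob (F i \<inter> H i))"
  proof (rule sum_mono)
    fix i assume i: "i \<in> I"
    have "prob (F i) * (1 / 2) \<le> prob (F i) * prob (H i)"
      using half[OF i] by (intro mult_left_mono) (auto simp: H_def Q_def)
    then show "prob (F i) \<le> 2 * prob (F i \<inter> H i)" using indep[OF i] by simp
  qed
  also have "\<dots> = 2 * prob (\<Union>i\<in>I. F i \<inter> H i)"
  proof -
    have "disjoint_family_on (\<lambda>i. F i \<inter> H i) I"
      using disj unfolding disjoint_family_on_def by blast
    then show ?thesis
      using fin Fm Hm by (subst finite_measure_finite_Union) (auto simp: sum_distrib_left)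
  qed
  also have "\<dots> \<le> 2 * prob {\<omega>\<in>space M. norm (\<Sum>k<J. \<xi> k \<omega>) < c + K}"
    using m[of "{..<J}"] by (intro mult_left_mono finite_measure_mono sub) (auto, measurable)
  finally show ?thesis .
qed

section \<open>Random walks and their resolvents\<close>

lemma Re_inverse_nonneg: "0 \<le> Re w \<Longrightarrow> 0 \<le> Re (1 / w)"
  by (simp add: Re_divide)

lemma set_integrable_ball_bounded:
  fixes f :: "'a::euclidean_space \<Rightarrow> real"
  assumes [measurable]: "f \<in> borel_measurable borel" and "\<And>z. \<bar>f z\<bar> \<le> B"
  shows "set_integrable lborel (ball c s) f"
  unfolding set_integrable_def
proof (rule Bochner_Integration.integrable_bound)
  show "integrable lborel (\<lambda>z. indicator (ball c s) z * B)"
    using emeasure_lborel_ball_finite[of c s]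
    by (intro integrable_mult_left integrable_real_indicator) auto
  show "AE z in lborel. norm (indicator (ball c s) z *\<^sub>R f z) \<le> norm (indicator (ball c s) z * B)"
    using order_trans[OF assms(2) abs_ge_self] by (auto split: split_indicator)
qed (use assms(1) in \<open>auto intro!: borel_measurable_times borel_measurable_indicator\<close>)

text \<open>
  An Abel summation argument: for nonnegative terms a bound along some \<open>r\<close> tending to 1 already bounds
  every partial sum.
\<close>

lemma nonneg_sums_bound:
  fixes c :: "nat \<Rightarrow> real"
  assumes "\<And>n. 0 \<le> c n" "\<exists>\<^sub>F r in at_left 1. \<exists>s\<le>C. (\<lambda>n. r ^ n * c n) sums s"
  shows "(\<Sum>n<N. c n) \<le> C"
proof (rule ccontr)
  assume "\<not> ?thesis"
  then have "C < (\<Sum>n<N. 1 ^ n * c n)" by simp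
  moreover have "((\<lambda>r. \<Sum>n<N. r ^ n * c n) \<longlongrightarrow> (\<Sum>n<N. 1 ^ n * c n)) (at_left 1)"
    by (intro tendsto_intros)
  ultimately have "\<forall>\<^sub>F r in at_left 1. C < (\<Sum>n<N. r ^ n * c n)"
    using order_tendstoD(1) by blast
  moreover have "\<forall>\<^sub>F r::real in at_left 1. 0 < r" 
    by (rule eventually_at_leftI[of 0]) auto
  ultimately have "\<forall>\<^sub>F r in at_left 1. \<not> (\<exists>s\<le>C. (\<lambda>n. r ^ n * c n) sums s)"
  proof eventually_elim
    case (elim r)
    show ?case
    proof
      assume "\<exists>s\<le>C. (\<lambda>n. r ^ n * c n) sums s"
      then obtain s where s: "s \<le> C" "(\<lambda>n. r ^ n * c n) sums s" by auto
      have "(\<Sum>n<N. r ^ n * c n) \<le> s"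
        using sum_le_suminf[of "\<lambda>n. r ^ n * c n" "{..<N}"] s(2) elim assms(1)
        by (auto simp: sums_iff)
      with s elim show False by linarith
    qed
  qed
  with assms(2) show False by (simp add: frequently_def)
qed

locale iid_steps = prob_space M for M :: "'w measure" +
  fixes \<xi> :: "nat \<Rightarrow> 'w \<Rightarrow> 'a::euclidean_space"
  assumes indep: "indep_vars (\<lambda>_. borel) \<xi> UNIV"
    and identical: "\<And>i. distr M borel (\<xi> i) = distr M borel (\<xi> 0)"
begin

definition walk :: "nat \<Rightarrow> 'w \<Rightarrow> 'a" where "walk n \<omega> = (\<Sum>i<n. \<xi> i \<omega>)"

lemma step_measurable [measurable]: "\<xi> i \<in> borel_measurable M"
  using indep by (auto simp: indep_vars_def)

lemma walk_measurable [measurable]: "walk n \<in> borel_measurable M"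
  unfolding walk_def[abs_def] by measurable

lemma char_fun_step: "char_fun M (\<xi> i) z = char_fun M (\<xi> 0) z"
proof -
  have "char_fun M (\<xi> i) z = (LINT x|distr M borel (\<xi> i). exp (\<i> * complex_of_real (z \<bullet> x)))" for i
    unfolding char_fun_def by (subst integral_distr) auto
  then show ?thesis by (simp only: identical[of i])
qed

lemma char_fun_walk: "char_fun M (walk n) z = char_fun M (\<xi> 0) z ^ n"
proof -
  have "char_fun M (walk n) z = (\<Prod>i<n. char_fun M (\<xi> i) z)"
    unfolding walk_def[abs_def]
    by (intro char_fun_sum indep_vars_subset[OF indep]) auto
  also have "\<dots> = (\<Prod>i<n. char_fun M (\<xi> 0) z)"
    by (intro prod.cong refl char_fun_step)
  finally show ?thesis by simp
qed

lemma resolvent_bound: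
  assumes "0 < r" "r < 1"
  shows "norm (1 / (1 - complex_of_real r * char_fun M (\<xi> 0) z)) \<le> 1 / (1 - r)"
    and "0 \<le> Re (1 / (1 - complex_of_real r * char_fun M (\<xi> 0) z))"
proof -
  have b: "norm (complex_of_real r * char_fun M (\<xi> 0) z) \<le> r"
    using norm_char_fun_le_1[of "\<xi> 0" z] assms by (simp add: norm_mult mult_left_le)
  have "1 - r \<le> norm (1 - complex_of_real r * char_fun M (\<xi> 0) z)"
    using norm_triangle_ineq2[of 1 "complex_of_real r * char_fun M (\<xi> 0) z"] b by simp
  then show "norm (1 / (1 - complex_of_real r * char_fun M (\<xi> 0) z)) \<le> 1 / (1 - r)"
    using assms by (auto simp: norm_divide intro!: divide_left_mono mult_pos_pos intro: less_le_trans[of 0 "1-r"])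
  show "0 \<le> Re (1 / (1 - complex_of_real r * char_fun M (\<xi> 0) z))"
    using complex_Re_le_cmod[of "complex_of_real r * char_fun M (\<xi> 0) z"] b assms
    by (intro Re_inverse_nonneg) simp
qed

lemma resolvent_integrable:
  assumes "finite_measure \<kappa>" "sets \<kappa> = sets borel" "0 < r" "r < 1"
  shows "integrable \<kappa> (\<lambda>z. 1 / (1 - complex_of_real r * char_fun M (\<xi> 0) z))"
proof -
  interpret K: finite_measure \<kappa> by fact
  have [measurable]: "char_fun M (\<xi> 0) \<in> borel_measurable \<kappa>"
    using char_fun_measurable[of "\<xi> 0"] by (simp add: measurable_cong_sets[OF assms(2) refl])
  show ?thesis
    using resolvent_bound(1)[OF assms(3,4)] by (intro K.integrable_const_bound[where B="1 / (1 - r)"]) auto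
qed

lemma resolvent_measurable [measurable]:
  "(\<lambda>z. 1 / (1 - complex_of_real r * char_fun M (\<xi> 0) z)) \<in> borel_measurable borel"
  using char_fun_measurable[of "\<xi> 0"] by measurable

text \<open>
  If \<open>h\<close> is the Fourier transform of a finite measure \<open>\<kappa>\<close>, Fubini gives \<open>E h (S\<^sub>n) = \<integral> \<phi>\<^sup>n d\<kappa>\<close>, and the
  weights \<open>r\<^sup>n\<close> turn the sum over \<open>n\<close> into a geometric series. Both directions of the
  criterion are instances of this identity, with \<open>\<kappa>\<close> Gaussian or the self-convolution of a ball.
\<close>

lemma walk_potential_sums:
  fixes \<kappa> :: "'a measure" and h :: "'a \<Rightarrow> real"
  assumes fin: "finite_measure \<kappa>" and sets: "sets \<kappa> = sets borel"
    and h: "\<And>x. (LINT z|\<kappa>. exp (\<i> * complex_of_real (z \<bullet> x))) = complex_of_real (h x)"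
    and r: "0 < r" "r < 1"
  shows "(\<lambda>n. r ^ n * (LINT \<omega>|M. h (walk n \<omega>))) sums
    (LINT z|\<kappa>. Re (1 / (1 - complex_of_real r * char_fun M (\<xi> 0) z)))"
proof -
  interpret K: finite_measure \<kappa> by (rule fin)
  interpret P: pair_sigma_finite M \<kappa> ..
  let ?\<phi> = "char_fun M (\<xi> 0)"
  have sets' [measurable_cong]: "sets \<kappa> = sets borel" by (rule sets)
  have [measurable]: "?\<phi> \<in> borel_measurable \<kappa>"
    using char_fun_measurable[of "\<xi> 0"] by (simp add: measurable_cong_sets[OF sets refl])
  have b: "norm (complex_of_real r * ?\<phi> z) \<le> r" for z
    using norm_char_fun_le_1[of "\<xi> 0" z] r by (simp add: norm_mult mult_left_le)
  have h': "h x = Re (LINT z|\<kappa>. exp (\<i> * complex_of_real (z \<bullet> x)))" for x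
    by (simp add: h)
  have hm [measurable]: "h \<in> borel_measurable borel"
    unfolding h'[abs_def] by measurable
  have hb: "\<bar>h x\<bar> \<le> measure \<kappa> (space \<kappa>)" for x
  proof -
    have "\<bar>h x\<bar> = norm (LINT z|\<kappa>. exp (\<i> * complex_of_real (z \<bullet> x)))" by (simp add: h)
    also have "\<dots> \<le> (LINT z|\<kappa>. norm (exp (\<i> * complex_of_real (z \<bullet> x))))" by (rule integral_norm_bound)
    finally show ?thesis by simp
  qed
  have step: "complex_of_real (LINT \<omega>|M. h (walk n \<omega>)) = (LINT z|\<kappa>. ?\<phi> z ^ n)" for n
  proof -
    have "complex_of_real (LINT \<omega>|M. h (walk n \<omega>)) = (LINT \<omega>|M. (LINT z|\<kappa>. exp (\<i> * complex_of_real (z \<bullet> walk n \<omega>))))"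
      by (simp add: h)
    also have "\<dots> = (LINT z|\<kappa>. (LINT \<omega>|M. exp (\<i> * complex_of_real (z \<bullet> walk n \<omega>))))"
    proof (rule P.Fubini_integral[symmetric])
      interpret MK: finite_measure "M \<Otimes>\<^sub>M \<kappa>"
        by (rule finite_measure_pair_measure) (rule fin, unfold_locales)
      show "integrable (M \<Otimes>\<^sub>M \<kappa>) (\<lambda>(\<omega>, z). exp (\<i> * complex_of_real (z \<bullet> walk n \<omega>)))"
        by (rule MK.integrable_const_bound[where B=1]) (auto simp: split_beta')
    qed
    also have "\<dots> = (LINT z|\<kappa>. ?\<phi> z ^ n)"
      by (simp add: char_fun_walk[unfolded char_fun_def] char_fun_def)
    finally show ?thesis .
  qed
  have "(\<lambda>n. (LINT z|\<kappa>. (complex_of_real r * ?\<phi> z) ^ n)) sums (LINT z|\<kappa>. (\<Sum>n. (complex_of_real r * ?\<phi> z) ^ n))"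
  proof (rule sums_integral)
    show "integrable \<kappa> (\<lambda>z. (complex_of_real r * ?\<phi> z) ^ n)" for n
    proof (rule K.integrable_const_bound[where B="1"])
      show "AE z in \<kappa>. norm ((complex_of_real r * ?\<phi> z) ^ n) \<le> 1"
        using b r by (auto simp: norm_power intro!: power_le_one order_trans[OF b])
    qed measurable
    show "AE z in \<kappa>. summable (\<lambda>n. norm ((complex_of_real r * ?\<phi> z) ^ n))"
      using b r by (auto simp: norm_power intro!: AE_I2 summable_geometric le_less_trans[OF b])
    show "summable (\<lambda>n. LINT z|\<kappa>. norm ((complex_of_real r * ?\<phi> z) ^ n))"
    proof (rule summable_comparison_test')
      show "summable (\<lambda>n. r ^ n * measure \<kappa> (space \<kappa>))"
        using r by (intro summable_mult2 summable_geometric) auto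
      show "norm (LINT z|\<kappa>. norm ((complex_of_real r * ?\<phi> z) ^ n)) \<le> r ^ n * measure \<kappa> (space \<kappa>)" for n
      proof -
        have "(LINT z|\<kappa>. norm ((complex_of_real r * ?\<phi> z) ^ n)) \<le> (LINT z|\<kappa>. r ^ n)"
          using less_imp_le[OF r(1)] by (intro integral_mono_AE' AE_I2) (auto simp only: norm_power intro!: power_mono b norm_ge_zero zero_le_power K.integrable_const)
        then show ?thesis by (simp add: mult.commute)
      qed
    qed
  qed
  also have "(\<lambda>n. (LINT z|\<kappa>. (complex_of_real r * ?\<phi> z) ^ n)) = (\<lambda>n. complex_of_real (r ^ n * (LINT \<omega>|M. h (walk n \<omega>))))"
    by (simp add: step power_mult_distrib)
  also have "(\<lambda>z. \<Sum>n. (complex_of_real r * ?\<phi> z) ^ n) = (\<lambda>z. 1 / (1 - complex_of_real r * ?\<phi> z))"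
    using b r by (intro ext suminf_geometric le_less_trans[OF b])
  finally have s: "(\<lambda>n. complex_of_real (r ^ n * (LINT \<omega>|M. h (walk n \<omega>)))) sums
     (LINT z|\<kappa>. 1 / (1 - complex_of_real r * ?\<phi> z))" .
  have "integrable \<kappa> (\<lambda>z. 1 / (1 - complex_of_real r * ?\<phi> z))"
    by (rule resolvent_integrable[OF fin sets r])
  then show ?thesis
    using sums_Re[OF s] by (simp add: integral_Re)
qed

section \<open>Transient walks have bounded resolvent integrals\<close>

lemma walk_diff: "walk (m + k) \<omega> - walk m \<omega> = (\<Sum>i<k. \<xi> (m + i) \<omega>)"
  by (induction k) (auto simp: walk_def algebra_simps)

lemma shifted_steps_law:
  "distr M (PiM UNIV (\<lambda>_. borel)) (\<lambda>\<omega> i. \<xi> (m + i) \<omega>) = PiM UNIV (\<lambda>_. distr M borel (\<xi> 0))"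
proof -
  have "indep_vars (\<lambda>j. PiM {m + j} (\<lambda>_. borel)) (\<lambda>j \<omega>. restrict (\<lambda>i. \<xi> i \<omega>) {m + j}) UNIV"
    by (rule indep_vars_restrict[OF indep]) (auto simp: disjoint_family_on_def)
  then have "indep_vars (\<lambda>_. borel) (\<lambda>j \<omega>. (\<lambda>f. f (m + j)) (restrict (\<lambda>i. \<xi> i \<omega>) {m + j})) UNIV"
    by (rule indep_vars_compose2[where Y="\<lambda>j f. f (m + j)"]) (auto intro!: measurable_component_singleton)
  then have "indep_vars (\<lambda>_. borel) (\<lambda>j. \<xi> (m + j)) UNIV" by simp
  then have "distr M (PiM UNIV (\<lambda>_. borel)) (\<lambda>\<omega>. \<lambda>i\<in>UNIV. \<xi> (m + i) \<omega>) = PiM UNIV (\<lambda>i. distr M borel (\<xi> (m + i)))"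
    by (subst (asm) indep_vars_iff_distr_eq_PiM) auto
  moreover have "(\<lambda>i. distr M borel (\<xi> (m + i))) = (\<lambda>_. distr M borel (\<xi> 0))"
    by (rule ext) (rule identical)
  ultimately show ?thesis by (simp add: restrict_def)
qed

text \<open>
  The walk restarted at time \<open>m\<close> has the law of the walk itself; the event concerns the entire future,
  so the laws of the infinite step sequences are compared.
\<close>

lemma avoidance_shift_invariant:
  "prob {\<omega>\<in>space M. \<forall>k\<ge>N. \<epsilon> \<le> norm (walk (m + k) \<omega> - walk m \<omega>)}
    = prob {\<omega>\<in>space M. \<forall>k\<ge>N. \<epsilon> \<le> norm (walk k \<omega>)}"
proof -
  let ?S = "{f\<in>space (PiM UNIV (\<lambda>_. borel)). \<forall>k\<ge>N. \<epsilon> \<le> norm (\<Sum>i<k. f i :: 'a)}"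
  have c: "(\<lambda>f. \<Sum>i<k. f i :: 'a) \<in> borel_measurable (PiM UNIV (\<lambda>_. borel))" for k
    by (rule borel_measurable_sum_components) auto
  have S: "?S \<in> sets (PiM UNIV (\<lambda>_. borel))"
    using c by measurable
  have "prob {\<omega>\<in>space M. \<forall>k\<ge>N. \<epsilon> \<le> norm (\<Sum>i<k. \<xi> (m + i) \<omega>)}
      = measure (PiM UNIV (\<lambda>_. distr M borel (\<xi> 0))) ?S" for m
  proof -
    have "(\<lambda>\<omega> i. \<xi> (m + i) \<omega>) \<in> measurable M (PiM UNIV (\<lambda>_. borel))"
      by (intro measurable_PiM_single') (auto simp: space_PiM)
    from measure_distr[OF this S] show ?thesis
      unfolding shifted_steps_law by (simp add: vimage_def space_PiM Int_def conj_commute)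
  qed
  from this[of m] this[of 0] show ?thesis
    unfolding walk_diff unfolding walk_def by simp
qed

text \<open>
  Some event \<open>E N\<close>, that the walk stays outside the \<open>\<epsilon>\<close>-ball from time \<open>N\<close> on, has positive
  probability. Let \<open>D m\<close> be the event that the walk is \<open>\<epsilon> / 2\<close>-close to \<open>y\<close> at time \<open>m\<close> and at distance
  at least \<open>\<epsilon>\<close> from that position from time \<open>m + N\<close> on. Then the walk is never again close to \<open>y\<close>
  after time \<open>m + N\<close>, so at most \<open>N\<close> of these events occur together; and by independence
  \<open>D m\<close> has the probability of a visit at time \<open>m\<close> times that of \<open>E N\<close>. The bound is uniform in \<open>y\<close>
  because the restarted walk does not depend on its position.
\<close>

lemma occupation_bound_if_transient:
  assumes "\<not> (AE \<omega> in M. \<exists>\<^sub>\<infinity>n. norm (walk n \<omega>) < \<epsilon>)"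
  obtains G where "0 \<le> G" "\<And>y L. (\<Sum>m<L. prob {\<omega>\<in>space M. norm (walk m \<omega> - y) < \<epsilon> / 2}) \<le> G"
proof -
  define E where "E N = {\<omega>\<in>space M. \<forall>k\<ge>N. \<epsilon> \<le> norm (walk k \<omega>)}" for N
  have Em: "E N \<in> events" for N unfolding E_def by measurable
  have "\<exists>N. prob (E N) \<noteq> 0"
  proof (rule ccontr)
    assume "\<not> ?thesis"
    then have "AE \<omega> in M. \<omega> \<notin> E N" for N
      using Em by (simp add: AE_iff_measurable[OF Em] prob_eq_0)
    then have "AE \<omega> in M. \<forall>N. \<omega> \<notin> E N" by (simp add: AE_all_countable)
    then have "AE \<omega> in M. \<exists>\<^sub>\<infinity>n. norm (walk n \<omega>) < \<epsilon>"
      by (rule AE_mp) (auto simp: E_def INFM_nat_le not_le)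
    with assms show False by simp
  qed
  then obtain N where "prob (E N) \<noteq> 0" by auto
  then have pos: "0 < prob (E N)" using measure_nonneg[of M "E N"] by linarith
  have key: "(\<Sum>m<L. prob {\<omega>\<in>space M. norm (walk m \<omega> - y) < \<epsilon> / 2}) * prob (E N) \<le> real N" for y L
  proof -
    define D where "D m = {\<omega>\<in>space M. norm (walk m \<omega> - y) < \<epsilon> / 2 \<and>
        (\<forall>k\<ge>N. \<epsilon> \<le> norm (walk (m + k) \<omega> - walk m \<omega>))}" for m
    have Dm [measurable]: "D m \<in> events" for m unfolding D_def by measurable
    have Di: "integrable M (indicat_real (D m))" for m
      by (simp add: integrable_real_indicator less_top[symmetric])
    have DP: "prob (D m) = prob {\<omega>\<in>space M. norm (walk m \<omega> - y) < \<epsilon> / 2} * prob (E N)" for m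
    proof -
      let ?P = "\<lambda>f. norm ((\<Sum>i<m. f i :: 'a) - y) < \<epsilon> / 2"
      let ?Q = "\<lambda>f. \<forall>k\<ge>N. \<epsilon> \<le> norm (\<Sum>i<k. f (m + i) :: 'a)"
      have "Measurable.pred (PiM {..<m} (\<lambda>_. borel)) ?P"
        using borel_measurable_sum_components[of "{..<m}" "\<lambda>k. k" "{..<m}"] by measurable
      moreover have "Measurable.pred (PiM {m..} (\<lambda>_. borel)) ?Q"
        using borel_measurable_sum_components[of "{..<k}" "\<lambda>i. m + i" "{m..}" for k] by measurable
      ultimately have "prob {\<omega>\<in>space M. ?P (\<lambda>i\<in>{..<m}. \<xi> i \<omega>) \<and> ?Q (\<lambda>i\<in>{m..}. \<xi> i \<omega>)}
       = prob {\<omega>\<in>space M. ?P (\<lambda>i\<in>{..<m}. \<xi> i \<omega>)} * prob {\<omega>\<in>space M. ?Q (\<lambda>i\<in>{m..}. \<xi> i \<omega>)}"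
        by (intro indep_vars_disjoint_blocks[OF indep]) auto
      moreover have "?P (\<lambda>i\<in>{..<m}. \<xi> i \<omega>) \<longleftrightarrow> norm (walk m \<omega> - y) < \<epsilon> / 2"
        "?Q (\<lambda>i\<in>{m..}. \<xi> i \<omega>) \<longleftrightarrow> (\<forall>k\<ge>N. \<epsilon> \<le> norm (walk (m + k) \<omega> - walk m \<omega>))" for \<omega>
        by (auto simp: walk_diff) (auto simp: walk_def)
      ultimately show ?thesis
        by (simp add: D_def avoidance_shift_invariant E_def)
    qed
    have count: "(\<Sum>m<L. indicator (D m) \<omega> :: real) \<le> real N" for \<omega>
    proof -
      define T where "T = {m. m < L \<and> \<omega> \<in> D m}"
      have finT: "finite T" by (simp add: T_def)
      have far: "\<not> m + N \<le> n" if "m \<in> T" "n \<in> T" for m n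
      proof
        assume le: "m + N \<le> n"
        have "\<forall>k\<ge>N. \<epsilon> \<le> norm (walk (m + k) \<omega> - walk m \<omega>)" using that by (auto simp: T_def D_def)
        from this[rule_format, of "n - m"] le have "\<epsilon> \<le> norm (walk n \<omega> - walk m \<omega>)" by simp
        also have "\<dots> \<le> norm (walk n \<omega> - y) + norm (walk m \<omega> - y)"
          using norm_triangle_ineq4[of "walk n \<omega> - y" "walk m \<omega> - y"] by simp
        also have "\<dots> < \<epsilon>" using that by (auto simp: T_def D_def)
        finally show False by simp
      qed
      have "card T \<le> N"
      proof (cases "T = {}")
        case False
        have "T \<subseteq> {Min T..<Min T + N}"
          using far[OF Min_in[OF finT False]] finT by (auto simp: not_le)
        then show ?thesis using card_mono[of "{Min T..<Min T + N}" T] by simp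
      qed simp
      moreover have "(\<Sum>m<L. indicator (D m) \<omega> :: real) = real (card T)"
        by (simp add: indicator_def T_def sum.If_cases Int_def)
      ultimately show ?thesis by simp
    qed
    have "(\<Sum>m<L. prob {\<omega>\<in>space M. norm (walk m \<omega> - y) < \<epsilon> / 2}) * prob (E N)
        = (\<Sum>m<L. LINT \<omega>|M. indicator (D m) \<omega>)"
      by (simp add: sum_distrib_right DP Dm)
    also have "\<dots> = (LINT \<omega>|M. (\<Sum>m<L. indicator (D m) \<omega>))"
      by (rule Bochner_Integration.integral_sum[symmetric]) (rule Di)
    also have "\<dots> \<le> (LINT \<omega>|M. real N)"
      by (intro integral_mono count Bochner_Integration.integrable_sum Di) auto
    finally show ?thesis by (simp add: prob_space)
  qed
  show thesis
  proof (rule that[of "real N / prob (E N)"])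
    show "(\<Sum>m<L. prob {\<omega>\<in>space M. norm (walk m \<omega> - y) < \<epsilon> / 2}) \<le> real N / prob (E N)" for y L
      using key[of y L] pos by (simp add: pos_le_divide_eq)
  qed simp
qed

text \<open>
  Up to a constant, \<open>exp (- |x|\<^sup>2 / 2)\<close> is dominated by the integral of \<open>exp (- |y|\<^sup>2 / 4)\<close> over a small ball around \<open>x\<close>.
  Exchanging the order of integration leaves the occupation of small balls with centre \<open>y\<close>, which is
  bounded uniformly in \<open>y\<close>, integrated against an integrable weight.
\<close>

lemma sum_gaussian_bounded_if_transient:
  assumes "\<not> (AE \<omega> in M. \<exists>\<^sub>\<infinity>n. norm (walk n \<omega>) < \<epsilon>)" and \<epsilon>: "0 < \<epsilon>"
  shows "\<exists>G. \<forall>L. (\<Sum>m<L. LINT \<omega>|M. exp (- ((norm (walk m \<omega>))\<^sup>2 / 2))) \<le> G"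
proof -
  obtain G where G: "0 \<le> G" "\<And>y L. (\<Sum>m<L. prob {\<omega>\<in>space M. norm (walk m \<omega> - y) < \<epsilon> / 2}) \<le> G"
    using occupation_bound_if_transient[OF assms(1)] by blast
  \<comment> \<open>The bound by 1 gives \<open>|y|\<^sup>2 \<le> 2 |x|\<^sup>2 + 2\<close> on the \<open>\<eta>\<close>-ball around \<open>x\<close>.\<close>
  define \<eta> where "\<eta> = min (\<epsilon> / 2) 1"
  have \<eta>: "0 < \<eta>" "\<eta> \<le> 1" "\<eta> \<le> \<epsilon> / 2" using \<epsilon> by (auto simp: \<eta>_def)
  define w where "w y = exp (- (1 / 4 * (norm y)\<^sup>2))" for y :: 'a
  have [measurable]: "w \<in> borel_measurable borel" unfolding w_def[abs_def] by measurable
  have w_nonneg: "0 \<le> w y" for y by (simp add: w_def)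
  have w_int: "integrable lborel w"
    unfolding w_def[abs_def] by (rule integrable_exp_neg_norm_sq) simp
  define v where "v = exp (- 1 / 2) * measure lborel (ball (0::'a) \<eta>)"
  have vpos: "0 < v"
    using \<eta> by (simp add: v_def content_ball_pos)
  have ball_eq: "measure lborel (ball x \<eta>) = measure lborel (ball (0::'a) \<eta>)" for x :: 'a
    using \<eta> by (simp add: content_ball)
  have pw: "ennreal (v * exp (- ((norm x)\<^sup>2 / 2))) \<le> (\<integral>\<^sup>+y. ennreal (w y) * indicator {y. norm (x - y) < \<eta>} y \<partial>lborel)" for x :: 'a
  proof -
    have "ennreal (v * exp (- ((norm x)\<^sup>2 / 2))) = ennreal (exp (- 1 / 2) * exp (- ((norm x)\<^sup>2 / 2))) * emeasure lborel (ball x \<eta>)"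
    proof -
      have "emeasure lborel (ball x \<eta>) = ennreal (measure lborel (ball (0::'a) \<eta>))"
        unfolding ball_eq[of x, symmetric]
        by (rule emeasure_eq_ennreal_measure) (use emeasure_lborel_ball_finite[of x \<eta>] in simp)
      then show ?thesis by (simp add: v_def ennreal_mult[symmetric] mult_ac)
    qed
    also have "\<dots> = (\<integral>\<^sup>+y. ennreal (exp (- 1 / 2) * exp (- ((norm x)\<^sup>2 / 2))) * indicator (ball x \<eta>) y \<partial>lborel)"
      by (simp add: nn_integral_cmult_indicator)
    also have "\<dots> \<le> (\<integral>\<^sup>+y. ennreal (w y) * indicator {y. norm (x - y) < \<eta>} y \<partial>lborel)"
    proof (rule nn_integral_mono)
      fix y :: 'a
      have "exp (- 1 / 2) * exp (- ((norm x)\<^sup>2 / 2)) \<le> w y" if "norm (x - y) < \<eta>"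
      proof -
        have "norm y \<le> norm x + 1"
          using norm_triangle_ineq2[of y x] that \<eta> by (simp add: norm_minus_commute)
        then have "(norm y)\<^sup>2 \<le> (norm x + 1)\<^sup>2" by (rule power_mono) simp
        moreover have "0 \<le> (norm x - 1)\<^sup>2" by simp
        ultimately have "(norm y)\<^sup>2 \<le> 2 * (norm x)\<^sup>2 + 2"
          unfolding power2_sum power2_diff by (simp add: field_simps)
        then show ?thesis by (simp add: w_def exp_add[symmetric])
      qed
      then show "ennreal (exp (- 1 / 2) * exp (- ((norm x)\<^sup>2 / 2))) * indicator (ball x \<eta>) y
          \<le> ennreal (w y) * indicator {y. norm (x - y) < \<eta>} y"
        by (auto simp: dist_norm ennreal_leI split: split_indicator)
    qed
    finally show ?thesis .
  qed
  interpret P: pair_sigma_finite M "lborel :: 'a measure" ..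
  let ?W = "LINT y|lborel. w y"
  have bound: "v * (\<Sum>m<L. LINT \<omega>|M. exp (- ((norm (walk m \<omega>))\<^sup>2 / 2))) \<le> G * ?W" for L
  proof -
    have gi: "integrable M (\<lambda>\<omega>. exp (- ((norm (walk m \<omega>))\<^sup>2 / 2)))" for m
      by (rule integrable_const_bound[where B=1]) auto
    have "ennreal (v * (\<Sum>m<L. LINT \<omega>|M. exp (- ((norm (walk m \<omega>))\<^sup>2 / 2))))
      = (\<Sum>m<L. \<integral>\<^sup>+\<omega>. ennreal (v * exp (- ((norm (walk m \<omega>))\<^sup>2 / 2))) \<partial>M)"
    proof -
      have "(\<integral>\<^sup>+\<omega>. ennreal (v * exp (- ((norm (walk m \<omega>))\<^sup>2 / 2))) \<partial>M)
        = ennreal (v * (LINT \<omega>|M. exp (- ((norm (walk m \<omega>))\<^sup>2 / 2))))" for m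
        using vpos gi[of m] by (subst nn_integral_eq_integral) auto
      moreover have "0 \<le> v * (LINT \<omega>|M. exp (- ((norm (walk m \<omega>))\<^sup>2 / 2)))" for m
        using vpos by simp
      ultimately show ?thesis
        by (simp add: sum_distrib_left sum_ennreal)
    qed
    also have "\<dots> \<le> (\<Sum>m<L. \<integral>\<^sup>+\<omega>. (\<integral>\<^sup>+y. ennreal (w y) * indicator {y. norm (walk m \<omega> - y) < \<eta>} y \<partial>lborel) \<partial>M)"
      by (intro sum_mono nn_integral_mono pw)
    also have "\<dots> = (\<Sum>m<L. \<integral>\<^sup>+y. (\<integral>\<^sup>+\<omega>. ennreal (w y) * indicator {y. norm (walk m \<omega> - y) < \<eta>} y \<partial>M) \<partial>lborel)"
      by (intro sum.cong refl P.Fubini'[symmetric]) measurable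
    also have "\<dots> = (\<Sum>m<L. \<integral>\<^sup>+y. ennreal (w y) * emeasure M {\<omega>\<in>space M. norm (walk m \<omega> - y) < \<eta>} \<partial>lborel)"
    proof (intro sum.cong refl nn_integral_cong)
      fix m y
      have "(\<integral>\<^sup>+\<omega>. ennreal (w y) * indicator {y. norm (walk m \<omega> - y) < \<eta>} y \<partial>M)
        = (\<integral>\<^sup>+\<omega>. ennreal (w y) * indicator {\<omega>\<in>space M. norm (walk m \<omega> - y) < \<eta>} \<omega> \<partial>M)"
        by (intro nn_integral_cong) (auto split: split_indicator)
      then show "(\<integral>\<^sup>+\<omega>. ennreal (w y) * indicator {y. norm (walk m \<omega> - y) < \<eta>} y \<partial>M)
         = ennreal (w y) * emeasure M {\<omega>\<in>space M. norm (walk m \<omega> - y) < \<eta>}"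
        by (simp add: nn_integral_cmult_indicator)
    qed
    also have "\<dots> = (\<integral>\<^sup>+y. (\<Sum>m<L. ennreal (w y) * emeasure M {\<omega>\<in>space M. norm (walk m \<omega> - y) < \<eta>}) \<partial>lborel)"
      by (rule nn_integral_sum[symmetric]) measurable
    also have "\<dots> \<le> (\<integral>\<^sup>+y. ennreal (G * w y) \<partial>lborel)"
    proof (rule nn_integral_mono)
      fix y :: 'a
      have "(\<Sum>m<L. prob {\<omega>\<in>space M. norm (walk m \<omega> - y) < \<eta>})
         \<le> (\<Sum>m<L. prob {\<omega>\<in>space M. norm (walk m \<omega> - y) < \<epsilon> / 2})"
        using \<eta> by (intro sum_mono finite_measure_mono) auto
      also have "\<dots> \<le> G" by (rule G)
      finally have "w y * (\<Sum>m<L. prob {\<omega>\<in>space M. norm (walk m \<omega> - y) < \<eta>}) \<le> G * w y"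
        by (simp add: w_def mult.commute)
      then show "(\<Sum>m<L. ennreal (w y) * emeasure M {\<omega>\<in>space M. norm (walk m \<omega> - y) < \<eta>}) \<le> ennreal (G * w y)"
        by (simp add: emeasure_eq_measure sum_distrib_left[symmetric] sum_ennreal ennreal_mult[symmetric] w_def sum_nonneg ennreal_leI)
    qed
    also have "\<dots> = ennreal (G * ?W)"
      using w_int G(1) by (subst nn_integral_eq_integral) (auto simp: w_nonneg)
    finally show ?thesis
      using G(1) by (subst (asm) ennreal_le_iff) (auto simp: w_nonneg intro!: mult_nonneg_nonneg integral_nonneg)
  qed
  show ?thesis
  proof (intro exI allI)
    fix L
    show "(\<Sum>m<L. LINT \<omega>|M. exp (- ((norm (walk m \<omega>))\<^sup>2 / 2))) \<le> G * ?W / v"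
      using bound[of L] vpos by (simp add: pos_le_divide_eq mult.commute)
  qed
qed

text \<open>
  Apply the potential identity to the Gaussian measure. On \<open>B\<^sub>a\<close> its density is bounded below, and the
  real part of the resolvent is nonnegative everywhere, so no cancellation can occur outside \<open>B\<^sub>a\<close>.
\<close>

lemma resolvent_integral_bounded_if_transient:
  assumes "\<not> (AE \<omega> in M. \<exists>\<^sub>\<infinity>n. norm (walk n \<omega>) < \<epsilon>)" and "0 < \<epsilon>"
  shows "\<exists>C. \<forall>r. 0 < r \<longrightarrow> r < 1 \<longrightarrow>
    (LINT z:ball 0 a|lborel. Re (1 / (1 - complex_of_real r * char_fun M (\<xi> 0) z))) \<le> C"
proof -
  obtain G where G: "\<And>L. (\<Sum>m<L. LINT \<omega>|M. exp (- ((norm (walk m \<omega>))\<^sup>2 / 2))) \<le> G"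
    using sum_gaussian_bounded_if_transient[OF assms] by blast
  define g where "g z = exp (- ((norm z)\<^sup>2 / 2))" for z :: 'a
  have gm [measurable]: "g \<in> borel_measurable borel" unfolding g_def[abs_def] by measurable
  have g_int: "integrable lborel g"
    using integrable_exp_neg_norm_sq[of "1/2", where 'a='a] by (simp add: g_def[abs_def])
  define \<kappa> where "\<kappa> = density lborel (\<lambda>z. ennreal (g z))"
  have fin: "finite_measure \<kappa>"
  proof (rule finite_measureI)
    have "emeasure \<kappa> (space \<kappa>) = (\<integral>\<^sup>+z. ennreal (g z) \<partial>lborel)"
      by (simp add: \<kappa>_def emeasure_density)
    also have "\<dots> = ennreal (LINT z|lborel. g z)"
      by (rule nn_integral_eq_integral[OF g_int]) (simp add: g_def)
    finally show "emeasure \<kappa> (space \<kappa>) \<noteq> \<infinity>" by simp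
  qed
  define \<gamma> where "\<gamma> = sqrt (2 * pi) ^ DIM('a)"
  have \<gamma>: "0 < \<gamma>" by (simp add: \<gamma>_def)
  have h: "(LINT z|\<kappa>. exp (\<i> * complex_of_real (z \<bullet> x))) = complex_of_real (\<gamma> * g x)" for x
    unfolding \<kappa>_def using gaussian_fourier[of x]
    by (subst integral_density) (auto simp: g_def \<gamma>_def scaleR_conv_of_real)
  let ?R = "\<lambda>r z. Re (1 / (1 - complex_of_real r * char_fun M (\<xi> 0) z))"
  have "(LINT z:ball 0 a|lborel. ?R r z) \<le> exp (a\<^sup>2 / 2) * (\<gamma> * G)" if r: "0 < r" "r < 1" for r
  proof -
    have s: "(\<lambda>n. r ^ n * (LINT \<omega>|M. \<gamma> * g (walk n \<omega>))) sums (LINT z|\<kappa>. ?R r z)"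
      by (rule walk_potential_sums[OF fin _ h r]) (simp add: \<kappa>_def)
    have le: "(\<Sum>n<L. r ^ n * (LINT \<omega>|M. \<gamma> * g (walk n \<omega>))) \<le> \<gamma> * G" for L
    proof -
      have "(\<Sum>n<L. r ^ n * (LINT \<omega>|M. \<gamma> * g (walk n \<omega>))) \<le> (\<Sum>n<L. (LINT \<omega>|M. \<gamma> * g (walk n \<omega>)))"
        using r \<gamma> by (intro sum_mono mult_left_le_one_le power_le_one integral_nonneg) (auto simp: g_def)
      also have "\<dots> = \<gamma> * (\<Sum>n<L. LINT \<omega>|M. g (walk n \<omega>))" by (simp add: sum_distrib_left)
      also have "\<dots> \<le> \<gamma> * G" using G[of L] \<gamma> by (simp add: g_def)
      finally show ?thesis .
    qed
    have 1: "(LINT z|\<kappa>. ?R r z) \<le> \<gamma> * G"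
      using s le by (intro LIMSEQ_le_const2[of "\<lambda>L. \<Sum>n<L. r ^ n * (LINT \<omega>|M. \<gamma> * g (walk n \<omega>))"])
        (auto simp: sums_def)
    have 2: "(LINT z|\<kappa>. ?R r z) = (LINT z|lborel. g z * ?R r z)"
      unfolding \<kappa>_def by (subst integral_density) (auto simp: g_def)
    have 3: "integrable lborel (\<lambda>z. g z * ?R r z)"
    proof -
      have "integrable \<kappa> (?R r)"
        using resolvent_integrable[OF fin _ r] by (intro integrable_Re) (simp add: \<kappa>_def)
      then show ?thesis
        unfolding \<kappa>_def by (subst (asm) integrable_density) (auto simp: g_def)
    qed
    have "(LINT z:ball 0 a|lborel. ?R r z) \<le> (LINT z|lborel. exp (a\<^sup>2 / 2) * (g z * ?R r z))"
      unfolding set_lebesgue_integral_def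
    proof (rule integral_mono_AE')
      show "integrable lborel (\<lambda>z. exp (a\<^sup>2 / 2) * (g z * ?R r z))" using 3 by simp
      have "indicator (ball 0 a) z *\<^sub>R ?R r z \<le> exp (a\<^sup>2 / 2) * (g z * ?R r z)" for z
      proof (cases "z \<in> ball 0 a")
        case True
        then have "(norm z)\<^sup>2 \<le> a\<^sup>2" by (intro power_mono) auto
        then have "1 \<le> exp (a\<^sup>2 / 2) * g z" by (simp add: g_def exp_add[symmetric])
        from mult_right_mono[OF this resolvent_bound(2)[OF r, of z]] True show ?thesis by (simp add: mult.assoc)
      next
        case False
        then show ?thesis using resolvent_bound(2)[OF r, of z] by (simp add: g_def)
      qed
      then show "AE z in lborel. indicator (ball 0 a) z *\<^sub>R ?R r z \<le> exp (a\<^sup>2 / 2) * (g z * ?R r z)" by simp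
      show "AE z in lborel. 0 \<le> exp (a\<^sup>2 / 2) * (g z * ?R r z)"
        using resolvent_bound(2)[OF r] by (simp add: g_def)
    qed
    also have "\<dots> = exp (a\<^sup>2 / 2) * (LINT z|\<kappa>. ?R r z)" by (simp add: 2)
    also have "\<dots> \<le> exp (a\<^sup>2 / 2) * (\<gamma> * G)" using 1 by simp
    finally show ?thesis .
  qed
  then show ?thesis by blast
qed

section \<open>Bounded resolvent integrals give finite occupation\<close>

text \<open>
  Let \<open>\<kappa>\<close> be the image of Lebesgue measure on \<open>B\<^sub>\<rho> \<times> B\<^sub>\<rho>\<close> under \<open>(y, y') \<mapsto> y - y'\<close>. It lives on the ball of radius
  \<open>2 \<rho>\<close> with density at most the volume \<open>V\<close> of \<open>B\<^sub>\<rho>\<close>, while its Fourier transform \<open>|u|\<^sup>2\<close> is nonnegative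
  everywhere and at least \<open>(V / 2)\<^sup>2\<close> on \<open>B\<^sub>K\<close>: for \<open>\<rho> K \<le> 1\<close> the phases \<open>y \<bullet> x\<close> have cosine at least
  one half.
\<close>

lemma occupation_bounded_if_resolvent_bounded:
  assumes \<rho>: "0 < \<rho>" "\<rho> * K \<le> 1"
    and bdd: "\<exists>\<^sub>F r in at_left 1.
       (LINT z:ball 0 (2 * \<rho>)|lborel. Re (1 / (1 - complex_of_real r * char_fun M (\<xi> 0) z))) \<le> C"
  shows "\<exists>C'. \<forall>N. (\<Sum>n<N. prob {\<omega>\<in>space M. norm (walk n \<omega>) < K}) \<le> C'"
proof -
  let ?B = "ball (0::'a) \<rho>"
  let ?R = "\<lambda>r z. Re (1 / (1 - complex_of_real r * char_fun M (\<xi> 0) z))"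
  define U where "U = density lborel (indicator ?B :: 'a \<Rightarrow> ennreal)"
  define V where "V = measure lborel ?B"
  have Vpos: "0 < V" using \<rho> by (simp add: V_def content_ball_pos)
  have sU [measurable_cong]: "sets U = sets borel" by (simp add: U_def)
  have finU: "finite_measure U"
  proof (rule finite_measureI)
    have "emeasure U (space U) = emeasure lborel ?B"
      unfolding U_def by (subst emeasure_density) (auto intro!: borel_measurable_indicator)
    then show "emeasure U (space U) \<noteq> \<infinity>"
      using emeasure_lborel_ball_finite[of "0::'a" \<rho>] by simp
  qed
  interpret U: finite_measure U by (rule finU)
  interpret UU: pair_sigma_finite U U ..
  interpret UxU: finite_measure "U \<Otimes>\<^sub>M U"
    by (rule finite_measure_pair_measure) (rule finU)+
  have int_U: "(LINT y|U. f y) = (LINT y:?B|lborel. f y)" if [measurable]: "f \<in> borel_measurable borel"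
    for f :: "'a \<Rightarrow> 'b::{banach,second_countable_topology}"
  proof -
    have "U = density lborel (\<lambda>y. ennreal (indicator ?B y))"
      by (simp add: U_def ennreal_indicator)
    then show ?thesis
      by (simp only: set_lebesgue_integral_def) (subst integral_density; simp add: borel_measurable_indicator)
  qed
  have AE_U: "AE y in U. P y" if "\<And>y. y \<in> ?B \<Longrightarrow> P y" for P
    unfolding U_def using that
    by (subst AE_density) (auto simp: borel_measurable_indicator indicator_def)
  have V: "measure U (space U) = V"
    using int_U[of "\<lambda>_. 1::real"] by (simp add: V_def set_lebesgue_integral_def)
  define \<kappa> where "\<kappa> = distr (U \<Otimes>\<^sub>M U) borel (\<lambda>(y, y'). y - y')"
  have fin: "finite_measure \<kappa>"
    unfolding \<kappa>_def by (rule UxU.finite_measure_distr) measurable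
  define u where "u x = (LINT y|U. exp (\<i> * complex_of_real (y \<bullet> x)))" for x
  have h: "(LINT z|\<kappa>. exp (\<i> * complex_of_real (z \<bullet> x))) = complex_of_real ((norm (u x))\<^sup>2)" for x
  proof -
    have "(LINT z|\<kappa>. exp (\<i> * complex_of_real (z \<bullet> x)))
      = (LINT p|(U \<Otimes>\<^sub>M U). exp (\<i> * complex_of_real ((fst p - snd p) \<bullet> x)))"
      unfolding \<kappa>_def by (subst integral_distr) (auto simp: split_beta')
    also have "\<dots> = (LINT y|U. (LINT y'|U. exp (\<i> * complex_of_real ((y - y') \<bullet> x))))"
    proof -
      have "integrable (U \<Otimes>\<^sub>M U) (\<lambda>p. exp (\<i> * complex_of_real ((fst p - snd p) \<bullet> x)))"
        by (rule UxU.integrable_const_bound[where B=1]) auto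
      from UU.integral_fst'[OF this] show ?thesis by simp
    qed
    also have "\<dots> = (LINT y|U. (LINT y'|U. exp (\<i> * complex_of_real (y \<bullet> x)) * cnj (exp (\<i> * complex_of_real (y' \<bullet> x)))))"
      by (simp add: exp_cnj exp_add[symmetric] inner_diff_left algebra_simps)
    also have "\<dots> = u x * cnj (u x)"
      by (simp add: u_def)
    finally show ?thesis by (simp only: complex_norm_square)
  qed
  have u_lower: "V / 2 \<le> norm (u x)" if "norm x < K" for x
  proof -
    have ui: "integrable U (\<lambda>y. exp (\<i> * complex_of_real (y \<bullet> x)))"
      by (rule U.integrable_const_bound[where B=1]) auto
    have c: "1 / 2 \<le> Re (exp (\<i> * complex_of_real (y \<bullet> x)))" if "y \<in> ?B" for y
    proof -
      have "\<bar>y \<bullet> x\<bar> \<le> norm y * norm x" by (rule Cauchy_Schwarz_ineq2)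
      also have "\<dots> \<le> \<rho> * K" using that \<rho> \<open>norm x < K\<close> by (intro mult_mono) auto
      finally have "\<bar>y \<bullet> x\<bar> \<le> pi / 3" using \<rho> pi_gt3 by linarith
      then have "cos (pi / 3) \<le> cos \<bar>y \<bullet> x\<bar>" by (intro cos_monotone_0_pi_le) auto
      then show ?thesis by (simp add: cos_60 Re_exp)
    qed
    have "V / 2 = (LINT y:?B|lborel. 1 / 2)" by (simp add: V_def set_lebesgue_integral_def)
    also have "\<dots> = (LINT y|U. 1 / 2)" by (rule int_U[symmetric]) simp
    also have "\<dots> \<le> (LINT y|U. Re (exp (\<i> * complex_of_real (y \<bullet> x))))"
    proof (rule integral_mono_AE)
      show "AE y in U. 1 / 2 \<le> Re (exp (\<i> * complex_of_real (y \<bullet> x)))"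
        using c by (rule AE_U)
    qed (use ui in auto)
    also have "\<dots> = Re (u x)" using ui by (simp add: u_def integral_Re)
    finally show ?thesis using complex_Re_le_cmod[of "u x"] by linarith
  qed
  have \<kappa>_le: "(LINT z|\<kappa>. ?R r z) \<le> V * (LINT z:ball 0 (2 * \<rho>)|lborel. ?R r z)" if r: "0 < r" "r < 1" for r
  proof -
    have Rm [measurable]: "?R r \<in> borel_measurable borel" by measurable
    have "(LINT z|\<kappa>. ?R r z) = (LINT p|(U \<Otimes>\<^sub>M U). ?R r (fst p - snd p))"
      unfolding \<kappa>_def by (subst integral_distr) (auto simp: split_beta')
    also have "\<dots> = (LINT y|U. (LINT y'|U. ?R r (y - y')))"
    proof -
      have "integrable (U \<Otimes>\<^sub>M U) (\<lambda>p. ?R r (fst p - snd p))"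
        using resolvent_bound(1)[OF r] abs_Re_le_cmod
        by (intro UxU.integrable_const_bound[where B="1 / (1 - r)"] AE_I2) (auto intro: order_trans)
      from UU.integral_fst'[OF this] show ?thesis by simp
    qed
    also have "\<dots> \<le> (LINT y|U. (LINT z:ball 0 (2 * \<rho>)|lborel. ?R r z))"
    proof (rule integral_mono_AE')
      have Rint: "set_integrable lborel (ball 0 s) (?R r)" for s
        using order_trans[OF abs_Re_le_cmod resolvent_bound(1)[OF r]]
        by (intro set_integrable_ball_bounded[where B="1 / (1 - r)"]) auto
      have "(LINT y'|U. ?R r (y - y')) \<le> (LINT z:ball 0 (2 * \<rho>)|lborel. ?R r z)" if "y \<in> ?B" for y
      proof -
        have "(LINT y'|U. ?R r (y - y')) = (LINT y'|lborel. indicator ?B y' *\<^sub>R ?R r (y - y'))"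
          by (subst int_U) (auto simp: set_lebesgue_integral_def)
        also have "\<dots> = (LINT z|lborel. indicator ?B (y - z) *\<^sub>R ?R r z)"
        proof -
          have "(lborel :: 'a measure) = distr lborel borel (\<lambda>z. y - z)"
            using lborel_affine[of "-1" y] by (simp add: density_1)
          then have "(LINT y'|lborel. indicator ?B y' *\<^sub>R ?R r (y - y'))
             = (LINT y'|distr lborel borel (\<lambda>z. y - z). indicator ?B y' *\<^sub>R ?R r (y - y'))" by simp
          also have "\<dots> = (LINT z|lborel. indicator ?B (y - z) *\<^sub>R ?R r z)"
          proof (subst integral_distr)
            show "(\<lambda>y'. indicator ?B y' *\<^sub>R ?R r (y - y')) \<in> borel_measurable borel"
              by (intro borel_measurable_scaleR borel_measurable_indicator measurable_compose[OF _ Rm]) auto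
          qed auto
          finally show ?thesis .
        qed
        also have "\<dots> \<le> (LINT z:ball 0 (2 * \<rho>)|lborel. ?R r z)"
          unfolding set_lebesgue_integral_def
        proof (rule integral_mono_AE')
          show "integrable lborel (\<lambda>z. indicator (ball 0 (2 * \<rho>)) z *\<^sub>R ?R r z)"
            using Rint[of "2 * \<rho>"] by (simp add: set_integrable_def)
          have "z \<in> ball 0 (2 * \<rho>)" if "y - z \<in> ?B" for z
            using that \<open>y \<in> ?B\<close> norm_triangle_ineq4[of y "y - z"] by simp
          then show "AE z in lborel. indicator ?B (y - z) *\<^sub>R ?R r z \<le> indicator (ball 0 (2 * \<rho>)) z *\<^sub>R ?R r z"
            using resolvent_bound(2)[OF r] by (auto split: split_indicator)
          show "AE z in lborel. 0 \<le> indicator (ball 0 (2 * \<rho>)) z *\<^sub>R ?R r z"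
            using resolvent_bound(2)[OF r] by auto
        qed
        finally show ?thesis .
      qed
      then show "AE y in U. (LINT y'|U. ?R r (y - y')) \<le> (LINT z:ball 0 (2 * \<rho>)|lborel. ?R r z)"
        by (rule AE_U)
      show "AE y in U. 0 \<le> (LINT z:ball 0 (2 * \<rho>)|lborel. ?R r z)"
        using resolvent_bound(2)[OF r] by (auto simp: set_lebesgue_integral_def intro!: integral_nonneg)
    qed simp
    also have "\<dots> = V * (LINT z:ball 0 (2 * \<rho>)|lborel. ?R r z)" by (simp add: V)
    finally show ?thesis .
  qed
  have um: "(\<lambda>x. (norm (u x))\<^sup>2) \<in> borel_measurable borel"
    unfolding u_def by measurable
  define c where "c n = (LINT \<omega>|M. (norm (u (walk n \<omega>)))\<^sup>2)" for n
  have bsum: "(\<Sum>n<N. c n) \<le> V * C" for N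
  proof (rule nonneg_sums_bound)
    show "0 \<le> c n" for n by (simp add: c_def)
    have "\<forall>\<^sub>F r::real in at_left 1. 0 < r \<and> r < 1"
      by (rule eventually_at_leftI[of 0]) auto
    with bdd have "\<exists>\<^sub>F r in at_left 1. (0 < r \<and> r < 1) \<and> (LINT z:ball 0 (2 * \<rho>)|lborel. ?R r z) \<le> C"
      by (rule frequently_eventually_conj)
    then show "\<exists>\<^sub>F r in at_left 1. \<exists>s\<le>V * C. (\<lambda>n. r ^ n * c n) sums s"
    proof (rule frequently_elim1)
      fix r assume r: "(0 < r \<and> r < 1) \<and> (LINT z:ball 0 (2 * \<rho>)|lborel. ?R r z) \<le> C"
      have "(\<lambda>n. r ^ n * c n) sums (LINT z|\<kappa>. ?R r z)"
        unfolding c_def using r by (intro walk_potential_sums[OF fin _ h]) (auto simp: \<kappa>_def)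
      moreover have "(LINT z|\<kappa>. ?R r z) \<le> V * C"
        using \<kappa>_le[of r] r Vpos by (meson mult_left_mono order_trans less_imp_le)
      ultimately show "\<exists>s\<le>V * C. (\<lambda>n. r ^ n * c n) sums s" by blast
    qed
  qed
  have ub: "norm (u x) \<le> V" for x
  proof -
    have "norm (u x) \<le> (LINT y|U. norm (exp (\<i> * complex_of_real (y \<bullet> x))))"
      unfolding u_def by (rule integral_norm_bound)
    then show ?thesis by (simp add: V)
  qed
  have cn: "(V / 2)\<^sup>2 * prob {\<omega>\<in>space M. norm (walk n \<omega>) < K} \<le> c n" for n
  proof -
    have "(V / 2)\<^sup>2 * prob {\<omega>\<in>space M. norm (walk n \<omega>) < K}
       = (LINT \<omega>|M. (V / 2)\<^sup>2 * indicator {\<omega>\<in>space M. norm (walk n \<omega>) < K} \<omega>)" by simp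
    also have "\<dots> \<le> c n"
      unfolding c_def
    proof (rule integral_mono_AE')
      show "integrable M (\<lambda>\<omega>. (norm (u (walk n \<omega>)))\<^sup>2)"
        using ub um by (intro integrable_const_bound[where B="V\<^sup>2"]) (auto intro!: power_mono)
      show "AE \<omega> in M. (V / 2)\<^sup>2 * indicator {\<omega>\<in>space M. norm (walk n \<omega>) < K} \<omega> \<le> (norm (u (walk n \<omega>)))\<^sup>2"
        using u_lower Vpos by (auto split: split_indicator intro!: power_mono)
    qed simp
    finally show ?thesis .
  qed
  have "(\<Sum>n<N. prob {\<omega>\<in>space M. norm (walk n \<omega>) < K}) \<le> V * C / (V / 2)\<^sup>2" for N
  proof -
    have "(V / 2)\<^sup>2 * (\<Sum>n<N. prob {\<omega>\<in>space M. norm (walk n \<omega>) < K}) \<le> (\<Sum>n<N. c n)"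
      unfolding sum_distrib_left by (intro sum_mono cn)
    also have "\<dots> \<le> V * C" by (rule bsum)
    finally show ?thesis using Vpos by (simp add: pos_le_divide_eq mult.commute)
  qed
  then show ?thesis by blast
qed

end

section \<open>Additive processes\<close>

context additive_process
begin

lemma increment_measurable: "0 \<le> s \<Longrightarrow> 0 \<le> t \<Longrightarrow> (\<lambda>\<omega>. X t \<omega> - X s \<omega>) \<in> borel_measurable M"
  using X_measurable by auto

lemma char_fun_increment_mult:
  assumes "0 \<le> s" "s \<le> t" "t \<le> u"
  shows "char_fun M (\<lambda>\<omega>. X u \<omega> - X s \<omega>) z
    = char_fun M (\<lambda>\<omega>. X t \<omega> - X s \<omega>) z * char_fun M (\<lambda>\<omega>. X u \<omega> - X t \<omega>) z"
proof (cases "s = t \<or> t = u")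
  case True
  then show ?thesis by (auto simp: char_fun_zero)
next
  case False
  define \<tau> where "\<tau> i = (if i = 0 then s else if i = 1 then t else u)" for i :: nat
  have "indep_vars (\<lambda>_. borel) (\<lambda>i \<omega>. X (\<tau> (Suc i)) \<omega> - X (\<tau> i) \<omega>) {..<2}"
    using assms False by (intro independent_increments) (auto simp: \<tau>_def less_2_cases_iff)
  from char_fun_sum[OF this, of z] show ?thesis
    by (simp add: \<tau>_def numeral_2_eq_2)
qed

lemma char_fun_X_eq_increment: "0 \<le> t \<Longrightarrow> char_fun M (X t) z = char_fun M (\<lambda>\<omega>. X t \<omega> - X 0 \<omega>) z"
  using start_zero X_measurable by (intro char_fun_cong_AE increment_measurable) auto

text \<open>
  By stochastic continuity the characteristic function of a short increment is close to 1 at \<open>z\<close>, so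
  whether the characteristic function of \<open>X t\<close> vanishes at \<open>z\<close> is locally constant in \<open>t\<close>. It does
  not vanish at \<open>t = 0\<close>.
\<close>

lemma char_fun_nonzero:
  assumes "0 \<le> t"
  shows "char_fun M (X t) z \<noteq> 0"
proof -
  let ?N = "\<lambda>t. char_fun M (X t) z \<noteq> 0"
  have step: "?N s \<longleftrightarrow> ?N t" if "0 \<le> s" "s \<le> t" "char_fun M (\<lambda>\<omega>. X t \<omega> - X s \<omega>) z \<noteq> 0" for s t
    using that char_fun_increment_mult[of 0 s t z] by (simp add: char_fun_X_eq_increment)
  have "?N 0 = ?N t"
  proof (rule connected_local_const[where A="{0..}" and f="?N"])
    show "\<forall>t\<in>{0..}. \<forall>\<^sub>F s in at t within {0..}. ?N t = ?N s"
    proof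
      fix t :: real assume "t \<in> {0..}"
      then have t: "0 \<le> t" by simp
      \<comment> \<open>With \<open>\<epsilon> |z| \<le> 1 / 4\<close> and a tail probability below \<open>1 / 4\<close>, the increment has a characteristic function within distance 1 of 1.\<close>
      define \<epsilon> where "\<epsilon> = 1 / (4 * (norm z + 1))"
      have n: "0 < norm z + 1" using norm_ge_zero[of z] by linarith
      then have \<epsilon>: "0 < \<epsilon>" by (simp add: \<epsilon>_def)
      have "\<epsilon> * norm z \<le> \<epsilon> * (norm z + 1)" using \<epsilon> by simp
      also have "\<dots> = 1 / 4" using n by (simp add: \<epsilon>_def)
      finally have \<epsilon>z: "\<epsilon> * norm z \<le> 1 / 4" .
      have "\<forall>\<^sub>F s in at t within {0..}. prob {\<omega>\<in>space M. \<epsilon> < norm (X s \<omega> - X t \<omega>)} < 1 / 4"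
        using stochastically_continuous[OF t \<epsilon>] by (rule order_tendstoD) simp
      moreover have "\<forall>\<^sub>F s in at t within {0..}. s \<in> {0..}"
        by (simp add: eventually_at_filter)
      ultimately show "\<forall>\<^sub>F s in at t within {0..}. ?N t = ?N s"
      proof eventually_elim
        case (elim s)
        then have s: "0 \<le> s" by simp
        have "norm (char_fun M (\<lambda>\<omega>. X s \<omega> - X t \<omega>) z - 1) < 1"
          using char_fun_near_1[OF increment_measurable[OF t s], of \<epsilon> z] \<epsilon> \<epsilon>z elim by linarith
        then have nz: "char_fun M (\<lambda>\<omega>. X s \<omega> - X t \<omega>) z \<noteq> 0" by auto
        then have nz': "char_fun M (\<lambda>\<omega>. X t \<omega> - X s \<omega>) z \<noteq> 0"
          using char_fun_uminus[of M "\<lambda>\<omega>. X s \<omega> - X t \<omega>" z] by simp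
        show ?case
        proof (cases "s \<le> t")
          case True
          show ?thesis by (rule step[OF s True nz', symmetric])
        next
          case False
          then show ?thesis by (intro step[OF t _ nz]) simp
        qed
      qed
    qed
  qed (use assms in \<open>auto simp: connected_iff_interval\<close>)
  then show ?thesis by (simp add: char_fun_X_eq_increment char_fun_zero)
qed

text \<open>
  Stochastic continuity makes tightness of the increments a locally uniform statement, and bisection
  extends it to the compact interval.
\<close>

lemma increments_to_end_tight:
  assumes "0 \<le> u"
  obtains K where "\<And>t. t \<in> {0..u} \<Longrightarrow> 1 / 2 \<le> prob {\<omega>\<in>space M. norm (X u \<omega> - X t \<omega>) < K}"
proof -
  let ?P = "\<lambda>a b. \<exists>K. \<forall>t\<in>{a..b} \<inter> {0..u}. 1 / 2 \<le> prob {\<omega>\<in>space M. norm (X u \<omega> - X t \<omega>) < K}"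
  have mono: "prob {\<omega>\<in>space M. norm (X u \<omega> - X t \<omega>) < K} \<le> prob {\<omega>\<in>space M. norm (X u \<omega> - X t \<omega>) < K'}"
    if "0 \<le> t" "K \<le> K'" for t K K'
  proof -
    have [measurable]: "(\<lambda>\<omega>. X u \<omega> - X t \<omega>) \<in> borel_measurable M"
      using increment_measurable[OF that(1) assms] .
    show ?thesis using that(2) by (intro finite_measure_mono) auto
  qed
  have "?P 0 u"
  proof (rule Bolzano[OF assms, where P="?P"])
    fix a b c assume "?P a b" "?P b c"
    then obtain K1 K2 where
      K: "\<forall>t\<in>{a..b} \<inter> {0..u}. 1 / 2 \<le> prob {\<omega>\<in>space M. norm (X u \<omega> - X t \<omega>) < K1}"
         "\<forall>t\<in>{b..c} \<inter> {0..u}. 1 / 2 \<le> prob {\<omega>\<in>space M. norm (X u \<omega> - X t \<omega>) < K2}" by blast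
    have "1 / 2 \<le> prob {\<omega>\<in>space M. norm (X u \<omega> - X t \<omega>) < max K1 K2}" if "t \<in> {a..c} \<inter> {0..u}" for t
    proof (cases "t \<le> b")
      case True
      then have "t \<in> {a..b} \<inter> {0..u}" using that by auto
      then have "1 / 2 \<le> prob {\<omega>\<in>space M. norm (X u \<omega> - X t \<omega>) < K1}" using K(1) by blast
      also have "\<dots> \<le> prob {\<omega>\<in>space M. norm (X u \<omega> - X t \<omega>) < max K1 K2}"
        using that by (intro mono) auto
      finally show ?thesis .
    next
      case False
      then have "t \<in> {b..c} \<inter> {0..u}" using that by auto
      then have "1 / 2 \<le> prob {\<omega>\<in>space M. norm (X u \<omega> - X t \<omega>) < K2}" using K(2) by blast
      also have "\<dots> \<le> prob {\<omega>\<in>space M. norm (X u \<omega> - X t \<omega>) < max K1 K2}"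
        using that by (intro mono) auto
      finally show ?thesis .
    qed
    then show "?P a c" by blast
  next
    fix x assume x: "0 \<le> x" "x \<le> u"
    note [measurable] = increment_measurable[OF x(1) assms]
    obtain K0 where K0: "prob {\<omega>\<in>space M. K0 \<le> norm (X u \<omega> - X x \<omega>)} < 1 / 4"
      using tight[of "\<lambda>\<omega>. X u \<omega> - X x \<omega>" "1/4"] by auto
    have "\<forall>\<^sub>F s in at x within {0..}. prob {\<omega>\<in>space M. 1 < norm (X s \<omega> - X x \<omega>)} < 1 / 4"
      using stochastically_continuous[OF x(1), of 1] by (rule order_tendstoD) simp_all
    then obtain d where d: "0 < d" "\<And>s. 0 \<le> s \<Longrightarrow> s \<noteq> x \<Longrightarrow> dist s x < d \<Longrightarrow>
        prob {\<omega>\<in>space M. 1 < norm (X s \<omega> - X x \<omega>)} < 1 / 4"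
      by (auto simp: eventually_at)
    have "1 / 2 \<le> prob {\<omega>\<in>space M. norm (X u \<omega> - X s \<omega>) < K0 + 1}" if s: "0 \<le> s" "dist s x < d" for s
    proof -
      note [measurable] = increment_measurable[OF s(1) assms] increment_measurable[OF x(1) s(1)]
      have "prob {\<omega>\<in>space M. 1 < norm (X s \<omega> - X x \<omega>)} < 1 / 4"
        using d(2)[OF s(1) _ s(2)] by (cases "s = x") auto
      moreover have "1 = prob {\<omega>\<in>space M. norm (X u \<omega> - X s \<omega>) < K0 + 1} + prob {\<omega>\<in>space M. \<not> norm (X u \<omega> - X s \<omega>) < K0 + 1}"
        by (subst prob_neg) auto
      moreover have "prob {\<omega>\<in>space M. \<not> norm (X u \<omega> - X s \<omega>) < K0 + 1}
         \<le> prob ({\<omega>\<in>space M. K0 \<le> norm (X u \<omega> - X x \<omega>)} \<union> {\<omega>\<in>space M. 1 < norm (X s \<omega> - X x \<omega>)})"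
      proof (rule finite_measure_mono)
        have "K0 \<le> norm (X u \<omega> - X x \<omega>) \<or> 1 < norm (X s \<omega> - X x \<omega>)"
          if "\<not> norm (X u \<omega> - X s \<omega>) < K0 + 1" for \<omega>
          using that norm_triangle_ineq4[of "X u \<omega> - X x \<omega>" "X s \<omega> - X x \<omega>"] by auto
        then show "{\<omega>\<in>space M. \<not> norm (X u \<omega> - X s \<omega>) < K0 + 1}
          \<subseteq> {\<omega>\<in>space M. K0 \<le> norm (X u \<omega> - X x \<omega>)} \<union> {\<omega>\<in>space M. 1 < norm (X s \<omega> - X x \<omega>)}"
          by blast
      qed measurable
      moreover have "prob ({\<omega>\<in>space M. K0 \<le> norm (X u \<omega> - X x \<omega>)} \<union> {\<omega>\<in>space M. 1 < norm (X s \<omega> - X x \<omega>)})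
         \<le> prob {\<omega>\<in>space M. K0 \<le> norm (X u \<omega> - X x \<omega>)} + prob {\<omega>\<in>space M. 1 < norm (X s \<omega> - X x \<omega>)}"
        by (rule measure_Un_le) measurable
      ultimately show ?thesis using K0 by linarith
    qed
    then have "?P a b" if "a \<le> x \<and> x \<le> b \<and> b - a < d" for a b
      using that by (intro exI[of _ "K0 + 1"]) (auto simp: dist_real_def)
    then show "\<exists>d>0. \<forall>a b. a \<le> x \<and> x \<le> b \<and> b - a < d \<longrightarrow> ?P a b"
      using d(1) by blast
  qed
  then obtain K where "\<forall>t\<in>{0..u} \<inter> {0..u}. 1 / 2 \<le> prob {\<omega>\<in>space M. norm (X u \<omega> - X t \<omega>) < K}" by blast
  then show thesis by (intro that[of K]) simp
qed

end

section \<open>Sampling a semi-Levy process along its period\<close>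

context semi_Levy_process
begin

lemma distr_increment_shift:
  assumes "0 \<le> s" "0 \<le> t"
  shows "distr M borel (\<lambda>\<omega>. X (t + real n * p) \<omega> - X (s + real n * p) \<omega>) = distr M borel (\<lambda>\<omega>. X t \<omega> - X s \<omega>)"
proof (induction n)
  case (Suc n)
  have "0 \<le> real n * p" using period_pos by simp
  then show ?case
    using periodic_increments[of "s + real n * p" "t + real n * p"] assms Suc
    by (simp add: algebra_simps)
qed simp

lemma iid_period_increments:
  assumes "0 \<le> s"
  shows "iid_steps M (\<lambda>i \<omega>. X (s + real (Suc i) * p) \<omega> - X (s + real i * p) \<omega>)"
proof (unfold_locales)
  let ?\<xi> = "\<lambda>i \<omega>. X (s + real (Suc i) * p) \<omega> - X (s + real i * p) \<omega>"
  have n: "indep_vars (\<lambda>_. borel) ?\<xi> {..<n}" for n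
    using independent_increments[of "\<lambda>i. s + real i * p" n] assms period_pos by simp
  have "?\<xi> i \<in> borel_measurable M" for i
    using n[of "Suc i"] by (auto simp: indep_vars_def)
  moreover have "indep_sets (\<lambda>i. {?\<xi> i -` A \<inter> space M |A. A \<in> sets borel}) UNIV"
  proof (subst indep_sets_finite_index_sets, intro allI impI)
    fix J :: "nat set" assume "finite J"
    then obtain n where "J \<subseteq> {..<n}" using finite_nat_iff_bounded by blast
    then show "indep_sets (\<lambda>i. {?\<xi> i -` A \<inter> space M |A. A \<in> sets borel}) J"
      using n[of n] unfolding indep_vars_def2 by (auto intro: indep_sets_mono_index)
  qed
  ultimately show "indep_vars (\<lambda>_. borel) ?\<xi> UNIV"
    by (simp add: indep_vars_def2)
  fix i
  show "distr M borel (?\<xi> i) = distr M borel (?\<xi> 0)"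
    using distr_increment_shift[of s "s + p" i] assms period_pos by (simp add: algebra_simps)
qed

lemma walk_period_increments:
  assumes "0 \<le> s"
  shows "iid_steps.walk (\<lambda>i \<omega>. X (s + real (Suc i) * p) \<omega> - X (s + real i * p) \<omega>) n \<omega>
    = X (s + real n * p) \<omega> - X s \<omega>"
proof -
  interpret S: iid_steps M "\<lambda>i \<omega>. X (s + real (Suc i) * p) \<omega> - X (s + real i * p) \<omega>"
    by (rule iid_period_increments[OF assms])
  show ?thesis
    unfolding S.walk_def by (subst sum_lessThan_telescope) simp
qed

text \<open>
  The two decompositions of \<open>X (s + p)\<close> at the times \<open>s\<close> and \<open>p\<close> give the same characteristic function.
  By periodicity the increment from \<open>p\<close> to \<open>s + p\<close> is distributed like \<open>X s\<close>, and the common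
  nonzero factor cancels.
\<close>

lemma char_fun_period_increment:
  assumes "0 \<le> s"
  shows "char_fun M (\<lambda>\<omega>. X (s + p) \<omega> - X s \<omega>) z = char_fun M (X p) z"
proof -
  have "char_fun M (X s) z * char_fun M (\<lambda>\<omega>. X (s + p) \<omega> - X s \<omega>) z = char_fun M (X (s + p)) z"
    using char_fun_increment_mult[of 0 s "s + p" z] assms period_pos by (simp add: char_fun_X_eq_increment)
  also have "\<dots> = char_fun M (X p) z * char_fun M (\<lambda>\<omega>. X (s + p) \<omega> - X p \<omega>) z"
    using char_fun_increment_mult[of 0 p "s + p" z] assms period_pos by (simp add: char_fun_X_eq_increment)
  also have "char_fun M (\<lambda>\<omega>. X (s + p) \<omega> - X p \<omega>) z = char_fun M (\<lambda>\<omega>. X s \<omega> - X 0 \<omega>) z"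
    using periodic_increments[of 0 s] assms period_pos
    by (intro char_fun_eq_if_distr_eq increment_measurable) auto
  also have "\<dots> = char_fun M (X s) z"
    using assms by (simp add: char_fun_X_eq_increment)
  finally show ?thesis using char_fun_nonzero[OF assms, of z] by (simp add: mult.commute)
qed

text \<open>
  Only the \<open>2 ^ m\<close> dyadic times of the \<open>n\<close>-th period are inspected, so that the event is a finite
  union; right continuity recovers all times of the period in the limit.
\<close>

definition visits_unit_ball :: "nat \<Rightarrow> nat \<Rightarrow> 'w set" where
  "visits_unit_ball n m = {\<omega>\<in>space M. \<exists>j<2 ^ m.
     norm (X (real n * p + real j * p / 2 ^ m) \<omega> - X 0 \<omega>) < 1}"

lemma visits_unit_ball_measurable: "visits_unit_ball n m \<in> events"
proof -
  have "(\<lambda>\<omega>. X (real n * p + real j * p / 2 ^ m) \<omega> - X 0 \<omega>) \<in> borel_measurable M" for j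
    using period_pos by (intro increment_measurable) auto
  then show ?thesis
    unfolding visits_unit_ball_def by measurable
qed

text \<open>
  This is the Ottaviani inequality for the process observed at time 0 and at the dyadic times
  of the \<open>n\<close>-th period, its end included. The condition \<open>0 < n\<close> keeps these times distinct.
\<close>

lemma prob_visits_unit_ball:
  assumes half: "\<And>t. t \<in> {0..p} \<Longrightarrow> 1 / 2 \<le> prob {\<omega>\<in>space M. norm (X p \<omega> - X t \<omega>) < K}"
    and n: "0 < n"
  shows "prob (visits_unit_ball n m) \<le> 2 * prob {\<omega>\<in>space M. norm (X (real (Suc n) * p) \<omega> - X 0 \<omega>) < 1 + K}"
proof -
  \<comment> \<open>Index 0 is time 0; the dyadic times start at index 1.\<close>
  define \<tau> where "\<tau> i = (case i of 0 \<Rightarrow> 0 | Suc j \<Rightarrow> real n * p + real j * p / 2 ^ m)" for i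
  define \<xi> where "\<xi> i \<omega> = X (\<tau> (Suc i)) \<omega> - X (\<tau> i) \<omega>" for i \<omega>
  let ?J = "Suc (2 ^ m)"
  have \<tau>0: "\<tau> 0 = 0" and \<tau>S: "\<tau> (Suc j) = real n * p + real j * p / 2 ^ m" for j
    by (simp_all add: \<tau>_def)
  have \<tau>J: "\<tau> ?J = p + real n * p" by (simp add: \<tau>S)
  have "indep_vars (\<lambda>_. borel) (\<lambda>i \<omega>. X (\<tau> (Suc i)) \<omega> - X (\<tau> i) \<omega>) {..<?J}"
  proof (rule independent_increments)
    show "\<tau> i < \<tau> (Suc i)" for i
      using n period_pos by (cases i) (auto simp: \<tau>0 \<tau>S field_simps)
  qed (simp add: \<tau>0)
  then have ind: "indep_vars (\<lambda>_. borel) \<xi> {..<?J}"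
    unfolding \<xi>_def[abs_def] .
  have tel: "(\<Sum>k<i. \<xi> k \<omega>) = X (\<tau> i) \<omega> - X 0 \<omega>" for i \<omega>
    unfolding \<xi>_def by (subst sum_lessThan_telescope) (simp add: \<tau>0)
  have tel': "(\<Sum>k\<in>{i..<?J}. \<xi> k \<omega>) = X (\<tau> ?J) \<omega> - X (\<tau> i) \<omega>" if "i \<le> ?J" for i \<omega>
    unfolding \<xi>_def using that by (subst sum_Suc_diff') auto
  have "prob {\<omega>\<in>space M. \<exists>i\<in>{1..2 ^ m}. norm (\<Sum>k<i. \<xi> k \<omega>) < 1}
    \<le> 2 * prob {\<omega>\<in>space M. norm (\<Sum>k<?J. \<xi> k \<omega>) < 1 + K}"
  proof (rule ottaviani[OF ind])
    fix i :: nat assume "i \<in> {1..2 ^ m}"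
    then obtain j where i: "i = Suc j" "j < 2 ^ m" by (cases i) auto
    define t where "t = real j * p / 2 ^ m"
    have "real j < 2 ^ m" using i(2) by (metis of_nat_less_iff of_nat_numeral of_nat_power)
    then have t: "t \<in> {0..p}" using period_pos by (simp add: t_def field_simps)
    have "1 / 2 \<le> prob {\<omega>\<in>space M. norm (X p \<omega> - X t \<omega>) < K}" by (rule half[OF t])
    also have "\<dots> = measure (distr M borel (\<lambda>\<omega>. X p \<omega> - X t \<omega>)) {x. norm x < K}"
      using t period_pos by (subst measure_distr) (auto intro!: increment_measurable arg_cong[where f=prob])
    also have "\<dots> = measure (distr M borel (\<lambda>\<omega>. X (p + real n * p) \<omega> - X (t + real n * p) \<omega>)) {x. norm x < K}"
      using t period_pos by (subst distr_increment_shift) auto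
    also have "\<dots> = prob {\<omega>\<in>space M. norm (X (p + real n * p) \<omega> - X (t + real n * p) \<omega>) < K}"
      using t period_pos by (subst measure_distr) (auto intro!: increment_measurable arg_cong[where f=prob])
    also have "\<dots> = prob {\<omega>\<in>space M. norm (\<Sum>k\<in>{i..<?J}. \<xi> k \<omega>) < K}"
    proof -
      have ti: "\<tau> i = t + real n * p" and iJ: "i \<le> ?J" using i by (simp_all add: \<tau>S t_def)
      show ?thesis unfolding tel'[OF iJ] \<tau>J ti ..
    qed
    finally show "1 / 2 \<le> prob {\<omega>\<in>space M. norm (\<Sum>k\<in>{i..<?J}. \<xi> k \<omega>) < K}" .
  qed auto
  also have "{\<omega>\<in>space M. \<exists>i\<in>{1..2 ^ m}. norm (\<Sum>k<i. \<xi> k \<omega>) < 1} = visits_unit_ball n m"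
  proof -
    have "(\<exists>i\<in>{1..2 ^ m}. Q i) \<longleftrightarrow> (\<exists>j<2 ^ m. Q (Suc j))" for Q :: "nat \<Rightarrow> bool"
      by (auto simp: Suc_le_eq) (metis Suc_le_D Suc_le_eq One_nat_def)
    then show ?thesis by (simp add: visits_unit_ball_def tel \<tau>S)
  qed
  finally show ?thesis
    by (simp only: tel \<tau>J) (simp add: algebra_simps)
qed

lemma visits_unit_ball_mono: "incseq (visits_unit_ball n)"
proof (rule incseq_SucI)
  fix m
  show "visits_unit_ball n m \<subseteq> visits_unit_ball n (Suc m)"
  proof
    fix \<omega> assume "\<omega> \<in> visits_unit_ball n m"
    then obtain j where j: "\<omega> \<in> space M" "j < 2 ^ m" "norm (X (real n * p + real j * p / 2 ^ m) \<omega> - X 0 \<omega>) < 1"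
      by (auto simp: visits_unit_ball_def)
    have e: "real (2 * j) * p / 2 ^ Suc m = real j * p / 2 ^ m" by simp
    show "\<omega> \<in> visits_unit_ball n (Suc m)"
      unfolding visits_unit_ball_def using j by (intro CollectI conjI exI[of _ "2 * j"]) (auto simp only: e, auto)
  qed
qed

text \<open>
  By right continuity the path stays near for a short time after \<open>t\<close>, and fine dyadic grids have a
  point in that interval.
\<close>

lemma visits_unit_ball_if_near:
  assumes \<omega>: "\<omega> \<in> space M" and t: "real n * p \<le> t" "t < real (Suc n) * p"
    and near: "norm (X t \<omega> - X 0 \<omega>) < 1"
  shows "\<exists>m. \<omega> \<in> visits_unit_ball n m"
proof -
  have t0: "0 \<le> t" using t(1) period_pos by (meson mult_nonneg_nonneg of_nat_0_le_iff less_imp_le order_trans)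
  have "((\<lambda>s. norm (X s \<omega> - X 0 \<omega>)) \<longlongrightarrow> norm (X t \<omega> - X 0 \<omega>)) (at_right t)"
    using right_continuous[OF \<omega> t0] unfolding continuous_within by (intro tendsto_intros)
  then have "\<forall>\<^sub>F s in at_right t. norm (X s \<omega> - X 0 \<omega>) < 1"
    using near by (rule order_tendstoD)
  then obtain b where b: "t < b" "\<And>s. t < s \<Longrightarrow> s < b \<Longrightarrow> norm (X s \<omega> - X 0 \<omega>) < 1"
    by (auto simp: eventually_at_right_field)
  \<comment> \<open>Capping at the end of the period ensures that the dyadic time belongs to the same period as \<open>t\<close>.\<close>
  define c where "c = min b (real (Suc n) * p)"
  have c: "t < c" using b t by (simp add: c_def)
  have near_c: "norm (X s \<omega> - X 0 \<omega>) < 1" if "t \<le> s" "s < c" for s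
    using that near b(2)[of s] by (cases "s = t") (auto simp: c_def)
  define x where "x = (t - real n * p) / p"
  have x: "0 \<le> x" using t period_pos by (simp add: x_def)
  obtain m where m: "(1 / 2) ^ m < (c - t) / p"
    using real_arch_pow_inv[of "(c - t) / p" "1/2"] c period_pos by auto
  define j where "j = nat \<lceil>2 ^ m * x\<rceil>"
  have j: "2 ^ m * x \<le> real j" "real j < 2 ^ m * x + 1"
    using x by (auto simp: j_def of_nat_nat) linarith+
  define s where "s = real n * p + real j * p / 2 ^ m"
  have "t = real n * p + x * p" using period_pos by (simp add: x_def)
  moreover have "x \<le> real j / 2 ^ m" using j(1) by (simp add: field_simps)
  then have "x * p \<le> real j / 2 ^ m * p" using period_pos by (intro mult_right_mono) auto
  ultimately have ts: "t \<le> s" by (simp add: s_def)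
  have "real j / 2 ^ m < x + (1 / 2) ^ m" using j(2) by (simp add: field_simps power_divide)
  also have "\<dots> < x + (c - t) / p" using m by simp
  finally have "real j / 2 ^ m * p < (x + (c - t) / p) * p" using period_pos by (intro mult_strict_right_mono)
  also have "\<dots> = c - real n * p" using period_pos by (simp add: x_def field_simps)
  finally have sc: "s < c" by (simp add: s_def)
  then have "real n * p + real j * p / 2 ^ m < real (Suc n) * p" by (simp add: s_def c_def)
  then have "real j * p < 2 ^ m * p" by (simp add: field_simps)
  then have "real j < real (2 ^ m)" using period_pos by simp
  then have "j < 2 ^ m" by (simp only: of_nat_less_iff)
  then show ?thesis
    unfolding visits_unit_ball_def using \<omega> near_c[OF ts sc] by (auto simp: s_def)
qed

text \<open>
  The hypothesis makes the probabilities of a visit to the unit ball during the \<open>n\<close>-th period summable,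
  so by Borel--Cantelli almost every path leaves the unit ball around its starting point for good.
\<close>

lemma not_recurrent_if_occupation_bounded:
  assumes "\<And>K. \<exists>C. \<forall>N. (\<Sum>n<N. prob {\<omega>\<in>space M. norm (X (real n * p) \<omega> - X 0 \<omega>) < K}) \<le> C"
  shows "\<not> recurrent_process M X"
proof
  assume rec: "recurrent_process M X"
  obtain K where K: "\<And>t. t \<in> {0..p} \<Longrightarrow> 1 / 2 \<le> prob {\<omega>\<in>space M. norm (X p \<omega> - X t \<omega>) < K}"
    using increments_to_end_tight[of p] period_pos by auto
  \<comment> \<open>The initial period is left out, as the hitting estimate concerns periods with positive index.\<close>
  define A where "A n = (\<Union>m. visits_unit_ball (Suc n) m)" for n
  have Am: "A n \<in> events" for n
    unfolding A_def using visits_unit_ball_measurable by auto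
  let ?P = "\<lambda>n. prob {\<omega>\<in>space M. norm (X (real n * p) \<omega> - X 0 \<omega>) < 1 + K}"
  have le: "prob (A n) \<le> 2 * ?P (Suc (Suc n))" for n
  proof (rule LIMSEQ_le_const2)
    show "(\<lambda>m. prob (visits_unit_ball (Suc n) m)) \<longlonglongrightarrow> prob (A n)"
      unfolding A_def using visits_unit_ball_measurable visits_unit_ball_mono
      by (intro finite_Lim_measure_incseq) auto
    show "\<exists>N. \<forall>m\<ge>N. prob (visits_unit_ball (Suc n) m) \<le> 2 * ?P (Suc (Suc n))"
      using prob_visits_unit_ball[OF K] by blast
  qed
  obtain C where C: "\<And>N. (\<Sum>n<N. ?P n) \<le> C" using assms by blast
  have "summable ?P"
    by (rule summableI_nonneg_bounded[where x=C]) (auto intro: C)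
  then have "summable (\<lambda>n. ?P (n + 2))"
    by (rule summable_ignore_initial_segment)
  then have "summable (\<lambda>n. 2 * ?P (Suc (Suc n)))"
    by (intro summable_mult) (simp only: add_2_eq_Suc')
  then have "summable (\<lambda>n. prob (A n))"
  proof (rule summable_comparison_test'[where N=0])
    show "norm (prob (A n)) \<le> 2 * ?P (Suc (Suc n))" for n
      using le[of n] by (simp only: real_norm_def abs_of_nonneg[OF measure_nonneg])
  qed
  then have "AE \<omega> in M. \<forall>\<^sub>F n in sequentially. \<omega> \<in> space M - A n"
    using Am by (intro borel_cantelli_AE1) (auto simp: less_top[symmetric])
  moreover have "AE \<omega> in M. Liminf at_top (\<lambda>t. ereal (norm (X t \<omega> - X 0 \<omega>))) = 0"
    using rec by (simp add: recurrent_process_def)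
  ultimately have "AE \<omega> in M. False"
  proof eventually_elim
    case (elim \<omega>)
    then obtain N where N: "\<And>n. N \<le> n \<Longrightarrow> \<omega> \<in> space M - A n"
      by (auto simp: eventually_sequentially)
    have "\<forall>\<^sub>F t in at_top. (1::ereal) \<le> ereal (norm (X t \<omega> - X 0 \<omega>))"
      unfolding eventually_at_top_linorder
    proof (intro exI allI impI)
      fix t :: real assume t: "real (Suc N) * p \<le> t"
      define n where "n = nat \<lfloor>t / p\<rfloor>"
      have "real (Suc N) \<le> t / p" using t period_pos by (simp add: field_simps)
      then have n: "Suc N \<le> n" "real n \<le> t / p" "t / p < real n + 1"
        by (auto simp: n_def le_nat_floor of_nat_nat)
      then obtain k where k: "n = Suc k" "N \<le> k" by (cases n) auto
      have tn: "real n * p \<le> t" "t < real (Suc n) * p"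
        using n period_pos by (auto simp: field_simps)
      have "\<omega> \<in> space M" "\<omega> \<notin> A k" using N[OF k(2)] by auto
      then have "\<not> norm (X t \<omega> - X 0 \<omega>) < 1"
        using visits_unit_ball_if_near[OF _ tn] unfolding A_def k(1) by blast
      then show "(1::ereal) \<le> ereal (norm (X t \<omega> - X 0 \<omega>))" by (simp add: one_ereal_def)
    qed
    then have "1 \<le> Liminf at_top (\<lambda>t. ereal (norm (X t \<omega> - X 0 \<omega>)))"
      by (rule Liminf_bounded)
    with elim show False by simp
  qed
  then show False by (simp add: AE_False)
qed

text \<open>
  The times \<open>s + n p\<close> tend to infinity, so visits of the walk to all small balls, infinitely often each,
  force the lower limit to vanish. Radii \<open>1 / (k + 1)\<close> suffice, which keeps the exceptional null sets
  countable in number.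
\<close>

lemma transient_walk_if_not_recurrent:
  assumes "\<not> recurrent_process M X"
  obtains s \<epsilon> where "0 \<le> s" "0 < \<epsilon>"
    "\<not> (AE \<omega> in M. \<exists>\<^sub>\<infinity>n. norm (X (s + real n * p) \<omega> - X s \<omega>) < \<epsilon>)"
proof -
  obtain s where s: "0 \<le> s" "\<not> (AE \<omega> in M. Liminf at_top (\<lambda>t. ereal (norm (X t \<omega> - X s \<omega>))) = 0)"
    using assms by (auto simp: recurrent_process_def)
  have "\<exists>k. \<not> (AE \<omega> in M. \<exists>\<^sub>\<infinity>n. norm (X (s + real n * p) \<omega> - X s \<omega>) < inverse (real (Suc k)))"
  proof (rule ccontr)
    assume "\<not> ?thesis"
    then have "AE \<omega> in M. \<forall>k. \<exists>\<^sub>\<infinity>n. norm (X (s + real n * p) \<omega> - X s \<omega>) < inverse (real (Suc k))"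
      by (simp add: AE_all_countable)
    then have "AE \<omega> in M. Liminf at_top (\<lambda>t. ereal (norm (X t \<omega> - X s \<omega>))) = 0"
    proof eventually_elim
      case (elim \<omega>)
      let ?L = "Liminf at_top (\<lambda>t. ereal (norm (X t \<omega> - X s \<omega>)))"
      have "0 \<le> ?L" by (rule Liminf_bounded) simp
      moreover have "\<not> 0 < ?L"
      proof
        assume "0 < ?L"
        then obtain e where e: "0 < ereal e" "ereal e < ?L" using ereal_dense2 by blast
        obtain k where k: "inverse (real (Suc k)) < e" using reals_Archimedean[of e] e(1) by auto
        have "\<forall>\<^sub>F t in at_top. ereal e < ereal (norm (X t \<omega> - X s \<omega>))"
          using e(2) by (rule less_LiminfD)
        moreover have "filterlim (\<lambda>n. s + real n * p) at_top sequentially"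
          using period_pos
          by (intro filterlim_tendsto_add_at_top[OF tendsto_const] filterlim_at_top_mult_tendsto_pos[OF tendsto_const] filterlim_real_sequentially)
        ultimately have "\<forall>\<^sub>F n in sequentially. ereal e < ereal (norm (X (s + real n * p) \<omega> - X s \<omega>))"
          unfolding filterlim_iff by blast
        then have "\<forall>\<^sub>F n in sequentially. \<not> norm (X (s + real n * p) \<omega> - X s \<omega>) < inverse (real (Suc k))"
          using k by (auto elim!: eventually_mono)
        with elim[rule_format, of k] show False
          by (simp add: frequently_def cofinite_eq_sequentially)
      qed
      ultimately show ?case by simp
    qed
    with s(2) show False by simp
  qed
  then obtain k where "\<not> (AE \<omega> in M. \<exists>\<^sub>\<infinity>n. norm (X (s + real n * p) \<omega> - X s \<omega>) < inverse (real (Suc k)))"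
    by blast
  then show thesis by (rule that[OF s(1), rotated]) simp
qed

end

section \<open>From the walk resolvent to the process resolvent\<close>

text \<open>
  The pole of \<open>1 / (1 - exp (- w))\<close> at the origin is that of \<open>1 / w\<close>: the difference is
  \<open>(exp (- w) - 1 + w) / (w (1 - exp (- w)))\<close>, whose numerator and denominator are both of order
  \<open>w\<^sup>2\<close>.
\<close>

lemma norm_inverse_one_minus_exp_diff:
  fixes w :: complex
  assumes "w \<noteq> 0" "norm w \<le> 1 / 4"
  shows "norm (1 / (1 - exp (- w)) - 1 / w) \<le> 4"
proof -
  have "norm (exp (- w) - (\<Sum>k\<le>1. (- w) ^ k / fact k)) \<le> exp \<bar>Re (- w)\<bar> * norm (- w) ^ Suc 1 / fact 1"
    by (rule Taylor_exp)
  then have t: "norm (exp (- w) - 1 + w) \<le> exp \<bar>Re w\<bar> * norm w ^ 2"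
    by (simp add: power2_eq_square algebra_simps)
  have "\<bar>Re w\<bar> \<le> 1 / 4"
    using abs_Re_le_cmod[of w] assms by linarith
  then have "exp \<bar>Re w\<bar> \<le> exp (1 / 4)" by simp
  also have "exp (1 / 4 :: real) \<le> 2"
    using exp_bound[of "1/4"] by (simp add: power2_eq_square)
  finally have "exp \<bar>Re w\<bar> * norm w ^ 2 \<le> 2 * norm w ^ 2"
    by (rule mult_right_mono) simp
  with t have num: "norm (exp (- w) - 1 + w) \<le> 2 * norm w ^ 2" by linarith
  have "2 * norm w ^ 2 \<le> norm w / 2"
    using mult_right_mono[OF assms(2), of "norm w"] by (simp add: power2_eq_square)
  moreover have "norm w \<le> norm (1 - exp (- w)) + norm (exp (- w) - 1 + w)"
    using norm_triangle_ineq[of "1 - exp (- w)" "exp (- w) - 1 + w"] by simp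
  ultimately have den: "norm w / 2 \<le> norm (1 - exp (- w))" using num by linarith
  then have nz: "1 - exp (- w) \<noteq> 0" using assms(1)
    by (metis divide_pos_pos norm_zero not_less zero_less_norm_iff zero_less_numeral)
  have "1 / (1 - exp (- w)) - 1 / w = (exp (- w) - 1 + w) / (w * (1 - exp (- w)))"
    using assms(1) nz by (simp add: field_simps)
  then have "norm (1 / (1 - exp (- w)) - 1 / w) = norm (exp (- w) - 1 + w) / (norm w * norm (1 - exp (- w)))"
    by (simp add: norm_divide norm_mult)
  also have "\<dots> \<le> (2 * norm w ^ 2) / (norm w * (norm w / 2))"
    using assms(1) num den by (intro frac_le mult_left_mono) auto
  also have "\<dots> = 4" using assms(1) by (simp add: power2_eq_square)
  finally show ?thesis .
qed

text \<open>
  Here \<open>w = q - \<psi>\<close>, so \<open>exp (- q) exp \<psi> = exp (- w)\<close>. For \<open>|\<psi>| \<le> 1 / 8\<close> both estimates come from the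
  Taylor expansion at \<open>w = 0\<close>. Otherwise \<open>|w| \<ge> |\<psi>|\<close>, since \<open>q\<close> and \<open>- Re \<psi>\<close> are both nonnegative, so
  \<open>1 / w\<close> is bounded while the walk resolvent has nonnegative real part. The second estimate is
  restricted to small \<open>\<psi>\<close> because the walk resolvent is unbounded near every \<open>\<psi> = 2 \<pi> i k\<close>.
\<close>

lemma resolvent_compare:
  fixes \<psi> :: complex
  assumes "Re \<psi> \<le> 0" "0 < q" "q \<le> 1 / 8"
  shows "Re (1 / (complex_of_real q - \<psi>)) \<le> Re (1 / (1 - complex_of_real (exp (- q)) * exp \<psi>)) + 8"
    and "norm \<psi> \<le> 1 / 8 \<Longrightarrow>
      Re (1 / (1 - complex_of_real (exp (- q)) * exp \<psi>)) \<le> Re (1 / (complex_of_real q - \<psi>)) + 4"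
proof -
  define w where "w = complex_of_real q - \<psi>"
  have Rew: "0 < Re w" using assms by (simp add: w_def)
  then have w0: "w \<noteq> 0" by auto
  have e: "complex_of_real (exp (- q)) * exp \<psi> = exp (- w)"
    by (simp add: w_def exp_of_real[symmetric] exp_add[symmetric])
  have small: "norm (1 / (1 - exp (- w)) - 1 / w) \<le> 4" if "norm \<psi> \<le> 1 / 8"
    using that assms norm_triangle_ineq4[of "complex_of_real q" \<psi>] w0
    by (intro norm_inverse_one_minus_exp_diff) (auto simp: w_def)
  have diff: "\<bar>Re (1 / (1 - exp (- w))) - Re (1 / w)\<bar> \<le> 4" if "norm \<psi> \<le> 1 / 8"
    using order_trans[OF abs_Re_le_cmod small[OF that]] by (simp only: minus_complex.sel)
  show "Re (1 / (1 - complex_of_real (exp (- q)) * exp \<psi>)) \<le> Re (1 / (complex_of_real q - \<psi>)) + 4"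
    if "norm \<psi> \<le> 1 / 8"
    using diff[OF that] unfolding e w_def[symmetric] by linarith
  show "Re (1 / (complex_of_real q - \<psi>)) \<le> Re (1 / (1 - complex_of_real (exp (- q)) * exp \<psi>)) + 8"
  proof (cases "norm \<psi> \<le> 1 / 8")
    case True
    then show ?thesis using diff unfolding e w_def[symmetric] by linarith
  next
    case False
    have "(norm \<psi>)\<^sup>2 \<le> (norm w)\<^sup>2"
    proof -
      have "(- Re \<psi>)\<^sup>2 \<le> (Re w)\<^sup>2" using assms by (intro power_mono) (auto simp: w_def)
      then show ?thesis by (simp add: cmod_power2 w_def)
    qed
    then have "norm \<psi> \<le> norm w" by (rule power2_le_imp_le) simp
    then have "norm (1 / w) \<le> 8" using False w0 by (simp add: norm_divide field_simps)
    then have "Re (1 / w) \<le> 8" using complex_Re_le_cmod[of "1 / w"] by linarith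
    moreover have "Re (exp (- w)) \<le> 1"
    proof (rule order_trans[OF complex_Re_le_cmod])
      show "norm (exp (- w)) \<le> 1" using Rew by simp
    qed
    then have "0 \<le> Re (1 / (1 - exp (- w)))" by (intro Re_inverse_nonneg) simp
    ultimately show ?thesis unfolding e w_def[symmetric] by linarith
  qed
qed

theorem corollary1p6:
  fixes M :: "'w measure" and X :: "real \<Rightarrow> 'w \<Rightarrow> 'a::euclidean_space"
    and p a :: real and \<psi> :: "'a \<Rightarrow> complex"
  assumes "semi_Levy_process M X p"
    and "\<psi> = distinguished_log (char_fun M (X p))"
    and "0 < a"
  shows "(recurrent_process M X \<longleftrightarrow>
           filterlim (\<lambda>q::real. LINT z:ball 0 a|lborel. Re (1 / (complex_of_real q - \<psi> z)))
             at_top (at_right 0)) \<and>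
         (recurrent_process M X \<longleftrightarrow>
           Limsup (at_right 0)
             (\<lambda>q::real. ereal (LINT z:ball 0 a|lborel. Re (1 / (complex_of_real q - \<psi> z)))) = \<infinity>)"
proof -
  interpret semi_Levy_process M X p by (rule assms(1))
  have p0: "0 \<le> p" using period_pos by simp
  let ?\<phi> = "char_fun M (X p)"
  have "\<exists>!g. continuous_on UNIV g \<and> g 0 = 0 \<and> (\<forall>z. exp (g z) = ?\<phi> z)"
  proof (rule distinguished_log_ex1)
    show "continuous_on UNIV ?\<phi>" by (intro continuous_char_fun X_measurable p0)
    show "?\<phi> z \<noteq> 0" for z by (rule char_fun_nonzero[OF p0])
    show "?\<phi> 0 = 1" by (simp add: char_fun_def prob_space)
  qed
  from theI'[OF this] have "continuous_on UNIV \<psi> \<and> \<psi> 0 = 0 \<and> (\<forall>z. exp (\<psi> z) = ?\<phi> z)"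
    unfolding assms(2) distinguished_log_def .
  then have \<psi>_cont: "continuous_on UNIV \<psi>" and \<psi>0: "\<psi> 0 = 0" and exp_\<psi>: "\<And>z. exp (\<psi> z) = ?\<phi> z" by auto
  have [measurable]: "\<psi> \<in> borel_measurable borel"
    using \<psi>_cont by (rule borel_measurable_continuous_onI)
  have Re_\<psi>: "Re (\<psi> z) \<le> 0" for z
    using norm_char_fun_le_1[OF X_measurable[OF p0], of z] by (simp add: exp_\<psi>[symmetric])
  define F where "F q z = Re (1 / (complex_of_real q - \<psi> z))" for q z
  define R where "R r z = Re (1 / (1 - complex_of_real r * ?\<phi> z))" for r z
  have F_nonneg: "0 \<le> F q z" if "0 < q" for q z
    unfolding F_def using that Re_\<psi>[of z] by (intro Re_inverse_nonneg) simp
  have F_int: "set_integrable lborel (ball 0 s) (F q)" if q: "0 < q" for q s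
  proof (rule set_integrable_ball_bounded)
    show "F q \<in> borel_measurable borel" unfolding F_def[abs_def] by measurable
    show "\<bar>F q z\<bar> \<le> 1 / q" for z
    proof -
      have "q \<le> norm (complex_of_real q - \<psi> z)"
        using complex_Re_le_cmod[of "complex_of_real q - \<psi> z"] Re_\<psi>[of z] by simp
      then have "norm (1 / (complex_of_real q - \<psi> z)) \<le> 1 / q"
        using q by (simp add: norm_divide frac_le)
      then show ?thesis unfolding F_def using abs_Re_le_cmod order_trans by blast
    qed
  qed
  note iid = iid_period_increments
  \<comment> \<open>The left-hand side is step 0 in the form in which the walk locale produces it.\<close>
  have walk_char: "char_fun M (\<lambda>\<omega>. X (s + real (Suc 0) * p) \<omega> - X (s + real 0 * p) \<omega>) = ?\<phi>" if "0 \<le> s" for s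
    using char_fun_period_increment[OF that] by (simp add: fun_eq_iff)
  have R_int: "set_integrable lborel (ball 0 s) (R r)" if r: "0 < r" "r < 1" for r s
  proof -
    interpret S: iid_steps M "\<lambda>i \<omega>. X (0 + real (Suc i) * p) \<omega> - X (0 + real i * p) \<omega>"
      by (rule iid) simp
    show ?thesis
      unfolding R_def[abs_def]
      using order_trans[OF abs_Re_le_cmod S.resolvent_bound(1)[OF r]] S.resolvent_measurable[of r]
      by (intro set_integrable_ball_bounded[where B="1 / (1 - r)"]) (auto simp only: walk_char[OF order_refl] intro!: measurable_compose[OF _ borel_measurable_Re])
  qed
  define I where "I q = (LINT z:ball 0 a|lborel. F q z)" for q
  let ?v = "\<lambda>s. measure lborel (ball (0::'a) s)"
  have const_int: "set_integrable lborel (ball (0::'a) s) (\<lambda>_. c)" for s and c :: real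
    by (rule set_integrable_ball_bounded[where B="\<bar>c\<bar>"]) auto
  have const_eq: "(LINT z:ball (0::'a) s|lborel. c) = c * ?v s" for s and c :: real
    by (simp add: set_lebesgue_integral_def)

  have transient: "\<exists>C. \<forall>\<^sub>F q in at_right 0. I q \<le> C" if nr: "\<not> recurrent_process M X"
  proof -
    obtain s \<epsilon> where s: "0 \<le> s" "0 < \<epsilon>"
      "\<not> (AE \<omega> in M. \<exists>\<^sub>\<infinity>n. norm (X (s + real n * p) \<omega> - X s \<omega>) < \<epsilon>)"
      using transient_walk_if_not_recurrent[OF nr] by blast
    interpret S: iid_steps M "\<lambda>i \<omega>. X (s + real (Suc i) * p) \<omega> - X (s + real i * p) \<omega>"
      by (rule iid[OF s(1)])
    have "\<not> (AE \<omega> in M. \<exists>\<^sub>\<infinity>n. norm (S.walk n \<omega>) < \<epsilon>)"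
      using s(3) by (simp only: walk_period_increments[OF s(1)] not_False_eq_True)
    from S.resolvent_integral_bounded_if_transient[OF this s(2), of a]
    obtain C where C: "\<And>r. 0 < r \<Longrightarrow> r < 1 \<Longrightarrow> (LINT z:ball 0 a|lborel. R r z) \<le> C"
      unfolding R_def walk_char[OF s(1)] by blast
    have "I q \<le> C + 8 * ?v a" if q: "0 < q" "q < 1 / 8" for q
    proof -
      have "I q \<le> (LINT z:ball 0 a|lborel. R (exp (- q)) z + 8)"
        unfolding I_def
      proof (rule set_integral_mono)
        show "set_integrable lborel (ball 0 a) (\<lambda>z. R (exp (- q)) z + 8)"
          using q by (intro set_integral_add R_int const_int) auto
        show "F q z \<le> R (exp (- q)) z + 8" for z
          using resolvent_compare(1)[OF Re_\<psi>, of q z] q by (simp add: F_def R_def exp_\<psi>)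
      qed (rule F_int[OF q(1)])
      also have "\<dots> = (LINT z:ball 0 a|lborel. R (exp (- q)) z) + 8 * ?v a"
        using q by (subst set_integral_add) (auto intro!: R_int const_int simp: const_eq)
      also have "\<dots> \<le> C + 8 * ?v a" using C[of "exp (- q)"] q by simp
      finally show ?thesis .
    qed
    then have "\<forall>\<^sub>F q in at_right 0. I q \<le> C + 8 * ?v a"
      by (intro eventually_at_rightI[of 0 "1/8"]) auto
    then show ?thesis by blast
  qed

  have recurrent: "filterlim I at_top (at_right 0)" if rec: "recurrent_process M X"
  proof (rule ccontr)
    assume "\<not> ?thesis"
    then obtain C where "\<not> (\<forall>\<^sub>F q in at_right 0. C \<le> I q)"
      by (auto simp: filterlim_at_top)
    then have freq: "\<exists>\<^sub>F q in at_right 0. \<not> C \<le> I q" by (simp add: not_eventually)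
    obtain d where d: "0 < d" "\<And>z. dist z 0 < d \<Longrightarrow> norm (\<psi> z) < 1 / 8"
      using \<psi>_cont[unfolded continuous_on_iff, rule_format, of 0 "1 / 8"] \<psi>0 by auto
    define \<delta> where "\<delta> = min d a"
    have \<delta>: "0 < \<delta>" "\<delta> \<le> a" "\<And>z. z \<in> ball 0 \<delta> \<Longrightarrow> norm (\<psi> z) \<le> 1 / 8"
      using d assms(3) by (auto simp: \<delta>_def less_imp_le)
    have R_le: "(LINT z:ball 0 (2 * \<rho>)|lborel. R (exp (- q)) z) \<le> I q + 4 * ?v a"
      if q: "0 < q" "q < 1 / 8" and \<rho>: "2 * \<rho> \<le> \<delta>" for q \<rho>
    proof -
      have "(LINT z:ball 0 (2 * \<rho>)|lborel. R (exp (- q)) z) \<le> (LINT z:ball 0 (2 * \<rho>)|lborel. F q z + 4)"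
      proof (rule set_integral_mono)
        show "set_integrable lborel (ball 0 (2 * \<rho>)) (\<lambda>z. F q z + 4)"
          using q by (intro set_integral_add F_int const_int) auto
        show "R (exp (- q)) z \<le> F q z + 4" if "z \<in> ball 0 (2 * \<rho>)" for z
          using resolvent_compare(2)[OF Re_\<psi>, of q z] \<delta>(3)[of z] that \<rho> q
          by (simp add: F_def R_def exp_\<psi>)
      qed (use q in \<open>auto intro!: R_int\<close>)
      also have "\<dots> \<le> (LINT z:ball 0 a|lborel. F q z + 4)"
        unfolding set_lebesgue_integral_def
      proof (rule integral_mono_AE')
        show "integrable lborel (\<lambda>z. indicat_real (ball 0 a) z *\<^sub>R (F q z + 4))"
          using set_integral_add(1)[OF F_int[OF q(1), of a] const_int[of a 4]] by (simp add: set_integrable_def)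
      qed (use F_nonneg[OF q(1)] \<rho> \<delta>(2) in \<open>auto split: split_indicator simp: add_nonneg_nonneg\<close>)
      also have "\<dots> = I q + 4 * ?v a"
        using q by (subst set_integral_add) (auto intro!: F_int const_int simp: const_eq I_def)
      finally show ?thesis .
    qed
    interpret S: iid_steps M "\<lambda>i \<omega>. X (0 + real (Suc i) * p) \<omega> - X (0 + real i * p) \<omega>"
      by (rule iid) simp
    have "\<exists>C'. \<forall>N. (\<Sum>n<N. prob {\<omega>\<in>space M. norm (X (real n * p) \<omega> - X 0 \<omega>) < K}) \<le> C'" for K
    proof -
      \<comment> \<open>The kernel then has nonnegligible mass at distance \<open>K\<close> and a Fourier transform supported where \<open>|\<psi>| \<le> 1 / 8\<close>.\<close>
      define \<rho> where "\<rho> = min (\<delta> / 2) (1 / (\<bar>K\<bar> + 1))"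
      have \<rho>: "0 < \<rho>" "2 * \<rho> \<le> \<delta>" using \<delta> by (auto simp: \<rho>_def)
      have "\<rho> * K \<le> \<rho> * (\<bar>K\<bar> + 1)" using \<rho> by (intro mult_left_mono) auto
      also have "\<dots> \<le> 1 / (\<bar>K\<bar> + 1) * (\<bar>K\<bar> + 1)" by (intro mult_right_mono) (auto simp: \<rho>_def)
      also have "\<dots> = 1" by simp
      finally have \<rho>K: "\<rho> * K \<le> 1" .
      have lim: "filterlim (\<lambda>q::real. exp (- q)) (at_left 1) (at_right 0)"
        by real_asymp
      have "\<exists>\<^sub>F r in at_left 1. (LINT z:ball 0 (2 * \<rho>)|lborel. R r z) \<le> C + 4 * ?v a"
      proof (rule ccontr)
        assume "\<not> ?thesis"
        then have "\<forall>\<^sub>F r in at_left 1. \<not> (LINT z:ball 0 (2 * \<rho>)|lborel. R r z) \<le> C + 4 * ?v a"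
          by (simp add: frequently_def)
        then have "\<forall>\<^sub>F q in at_right 0. \<not> (LINT z:ball 0 (2 * \<rho>)|lborel. R (exp (- q)) z) \<le> C + 4 * ?v a"
          using lim unfolding filterlim_iff by blast
        moreover have "\<forall>\<^sub>F q::real in at_right 0. 0 < q \<and> q < 1 / 8"
          by (intro eventually_at_rightI[of 0 "1/8"]) auto
        ultimately have "\<forall>\<^sub>F q in at_right 0. C \<le> I q"
        proof eventually_elim
          case (elim q)
          then show ?case using R_le[of q \<rho>] \<rho> by linarith
        qed
        with freq show False by (simp add: frequently_def)
      qed
      then have "\<exists>\<^sub>F r in at_left 1. (LINT z:ball 0 (2 * \<rho>)|lborel. Re (1 / (1 - complex_of_real r *
          char_fun M (\<lambda>\<omega>. X (0 + real (Suc 0) * p) \<omega> - X (0 + real 0 * p) \<omega>) z))) \<le> C + 4 * ?v a"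
        unfolding R_def walk_char[OF order_refl] .
      from S.occupation_bounded_if_resolvent_bounded[OF \<rho>(1) \<rho>K this]
      show ?thesis unfolding walk_period_increments[OF order_refl] by simp
    qed
    from not_recurrent_if_occupation_bounded[OF this] rec show False by simp
  qed

  have lim_imp: "Limsup (at_right 0) (\<lambda>q. ereal (I q)) = \<infinity>" if "filterlim I at_top (at_right 0)"
    using that by (intro lim_imp_Limsup) (auto simp: tendsto_PInfty_eq_at_top)
  have Limsup_imp: "recurrent_process M X" if L: "Limsup (at_right 0) (\<lambda>q. ereal (I q)) = \<infinity>"
  proof (rule ccontr)
    assume "\<not> ?thesis"
    then obtain C where C: "\<forall>\<^sub>F q in at_right 0. I q \<le> C" using transient by blast
    then have "Limsup (at_right 0) (\<lambda>q. ereal (I q)) \<le> ereal C"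
      by (intro Limsup_bounded) (simp add: eventually_mono)
    with L show False by simp
  qed
  have "(recurrent_process M X \<longleftrightarrow> filterlim I at_top (at_right 0)) \<and>
        (recurrent_process M X \<longleftrightarrow> Limsup (at_right 0) (\<lambda>q. ereal (I q)) = \<infinity>)"
    using recurrent lim_imp Limsup_imp by blast
  then show ?thesis unfolding I_def F_def .
qed

end
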